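(* Let $\langle X_i:i\in\omega\rangle$ be a sequence of finite nonempty sets, $n_i$ a good norm on $X_i$ for each $i$, $m_i=n_0*n_1*\dots*n_i$, and $k=\lim_im_i$ the limit norm on $X=\prod_iX_i$ (with the product topology). Then the derived submeasure $c(A)=k(\chi_A)$, $A\subseteq X$, is an outer regular stable capacity on $X$.
   Context: A good norm on a set $Y$ is a norm $n$ on functions $f\in\mathbb{R}^Y$ (values in $[0,\infty)$) such that $|f|\le|g|$ pointwise implies $n(f)\le n(g)$, $n(1)=1$, and, if $Y$ is finite, $|f|<|g|$ implies $n(f)<n(g)$. For good norms $n$ on $Y$ and $m$ on $Z$, the iteration $n*m$ on $Y\times Z$ is $(n*m)(f)=n(y\mapsto m(z\mapsto f(y,z)))$. The limit $k=\lim_i m_i$ on $X=\prod_iX_i$: for a nonnegative step function $f$ (there is $j$ such that $f(x)$ depends only on $x\restriction(j+1)$, say $f(x)=f^*(x\restriction(j+1))$ with $f^*$ defined on $X_0\times\dots\times X_j$) put $k(f)=m_j(f^* )$; for a nonnegative lower semicontinuous $g=\sup_nf_n$ with $f_0\le f_1\le\dots$ nonnegative step functions put $k(g)=\sup_nk(f_n)$; for arbitrary $h$ put $k(h)=\inf\{k(g):|h|\le g,\ g \text{ lower semicontinuous}\}$. A capacity on a Polish space $X$ is $c:\mathcal{P}(X)\to[0,\infty]$ with $c(\emptyset)=0$, monotone, $c(A\cup B)\le c(A)+c(B)$, $c(\bigcup_nA_n)=\sup_nc(A_n)$ for inclusion-increasing sequences, $c(K)<\infty$ for compact $K$; outer regular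 means $c(A)=\inf\{c(O):O\supseteq A$ open$\}$. Stable: for every open $A$ there is a Borel $\tilde A\supseteq A$ with $c(\tilde A)=c(A)$ such that $c(A\cup B)>c(A)$ whenever $B\subseteq X\setminus\tilde A$ and $c(B)>0$. *)

theory Defs
  imports "HOL-Analysis.Analysis"
begin

text \<open>
  A norm on \<open>\<real>\<^sup>Y\<close> is a functional on all functions of the ambient type. The laws only look at
  values on \<open>Y\<close>; monotonicity then forces \<open>n f\<close> to depend on the restriction of \<open>f\<close> to \<open>Y\<close> only.
  In the last clause \<open>\<bar>f\<bar> < \<bar>g\<bar>\<close> is the strict part of the pointwise order:
  \<open>\<bar>f\<bar> \<le> \<bar>g\<bar>\<close> and \<open>\<bar>f\<bar> \<noteq> \<bar>g\<bar>\<close> on \<open>Y\<close>.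
\<close>

definition norm_on :: "'y set \<Rightarrow> (('y \<Rightarrow> real) \<Rightarrow> real) \<Rightarrow> bool" where
  "norm_on Y n \<longleftrightarrow>
     (\<forall>f. 0 \<le> n f) \<and>
     (\<forall>f. n f = 0 \<longleftrightarrow> (\<forall>y\<in>Y. f y = 0)) \<and>
     (\<forall>a f. n (\<lambda>y. a * f y) = \<bar>a\<bar> * n f) \<and>
     (\<forall>f g. n (\<lambda>y. f y + g y) \<le> n f + n g)"

definition good_norm :: "'y set \<Rightarrow> (('y \<Rightarrow> real) \<Rightarrow> real) \<Rightarrow> bool" where
  "good_norm Y n \<longleftrightarrow>
     norm_on Y n \<and>
     (\<forall>f g. (\<forall>y\<in>Y. \<bar>f y\<bar> \<le> \<bar>g y\<bar>) \<longrightarrow> n f \<le> n g) \<and>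
     n (\<lambda>_. 1) = 1 \<and>
     (finite Y \<longrightarrow>
        (\<forall>f g. (\<forall>y\<in>Y. \<bar>f y\<bar> \<le> \<bar>g y\<bar>) \<and> (\<exists>y\<in>Y. \<bar>f y\<bar> \<noteq> \<bar>g y\<bar>) \<longrightarrow> n f < n g))"

definition norm_iteration ::
    "(('y \<Rightarrow> real) \<Rightarrow> real) \<Rightarrow> (('z \<Rightarrow> real) \<Rightarrow> real) \<Rightarrow> ('y \<times> 'z \<Rightarrow> real) \<Rightarrow> real" where
  "norm_iteration n m f = n (\<lambda>y. m (\<lambda>z. f (y, z)))"

text \<open>
  \<open>iterated_norm n i\<close> is \<open>n 0 * \<dots> * n i\<close> as a norm on \<open>Pi\<^sub>E {..i} X\<close>, where
  \<open>Pi\<^sub>E {..i} X \<times> X (Suc i)\<close> is identified with \<open>Pi\<^sub>E {..Suc i} X\<close> by appending the last coordinate.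
\<close>

primrec iterated_norm ::
    "(nat \<Rightarrow> ('a \<Rightarrow> real) \<Rightarrow> real) \<Rightarrow> nat \<Rightarrow> ((nat \<Rightarrow> 'a) \<Rightarrow> real) \<Rightarrow> real" where
  "iterated_norm n 0 = (\<lambda>f. n 0 (\<lambda>a. f ((\<lambda>_. undefined)(0 := a))))"
| "iterated_norm n (Suc i) =
     (\<lambda>f. norm_iteration (iterated_norm n i) (n (Suc i)) (\<lambda>(s, a). f (s(Suc i := a))))"

abbreviation product_space :: "(nat \<Rightarrow> 'a set) \<Rightarrow> (nat \<Rightarrow> 'a) topology" where
  "product_space X \<equiv> product_topology (\<lambda>i. discrete_topology (X i)) UNIV"

definition step_witness ::
    "(nat \<Rightarrow> 'a set) \<Rightarrow> ((nat \<Rightarrow> 'a) \<Rightarrow> real) \<Rightarrow> nat \<Rightarrow> ((nat \<Rightarrow> 'a) \<Rightarrow> real) \<Rightarrow> bool" where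
  "step_witness X f j f' \<longleftrightarrow> (\<forall>x\<in>Pi\<^sub>E UNIV X. f x = f' (restrict x {..j}))"

definition nonneg_step :: "(nat \<Rightarrow> 'a set) \<Rightarrow> ((nat \<Rightarrow> 'a) \<Rightarrow> real) \<Rightarrow> bool" where
  "nonneg_step X f \<longleftrightarrow> (\<forall>x\<in>Pi\<^sub>E UNIV X. 0 \<le> f x) \<and> (\<exists>j f'. step_witness X f j f')"

definition lower_semicontinuous :: "'x topology \<Rightarrow> ('x \<Rightarrow> real) \<Rightarrow> bool" where
  "lower_semicontinuous T g \<longleftrightarrow> (\<forall>r. openin T {x \<in> topspace T. r < g x})"

definition step_approximation ::
    "(nat \<Rightarrow> 'a set) \<Rightarrow> (nat \<Rightarrow> (nat \<Rightarrow> 'a) \<Rightarrow> real) \<Rightarrow> ((nat \<Rightarrow> 'a) \<Rightarrow> real) \<Rightarrow> bool" where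
  "step_approximation X f g \<longleftrightarrow>
     (\<forall>i. nonneg_step X (f i)) \<and>
     (\<forall>x\<in>Pi\<^sub>E UNIV X. \<forall>i. f i x \<le> f (Suc i) x) \<and>
     (\<forall>x\<in>Pi\<^sub>E UNIV X. (SUP i. ennreal (f i x)) = ennreal (g x))"

text \<open>
  The limit norm, in three stages. The first two stages take the common value over all
  representations \<open>f'\<close>, respectively over all increasing approximations by step functions.
\<close>

definition limit_norm_step ::
    "(nat \<Rightarrow> 'a set) \<Rightarrow> (nat \<Rightarrow> ((nat \<Rightarrow> 'a) \<Rightarrow> real) \<Rightarrow> real) \<Rightarrow> ((nat \<Rightarrow> 'a) \<Rightarrow> real) \<Rightarrow> real" where
  "limit_norm_step X m f = (THE r. \<exists>j f'. step_witness X f j f' \<and> r = m j f')"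

definition limit_norm_lsc ::
    "(nat \<Rightarrow> 'a set) \<Rightarrow> (nat \<Rightarrow> ((nat \<Rightarrow> 'a) \<Rightarrow> real) \<Rightarrow> real) \<Rightarrow> ((nat \<Rightarrow> 'a) \<Rightarrow> real) \<Rightarrow> ennreal" where
  "limit_norm_lsc X m g =
     (THE r. \<exists>f. step_approximation X f g \<and> r = (SUP i. ennreal (limit_norm_step X m (f i))))"

definition limit_norm ::
    "(nat \<Rightarrow> 'a set) \<Rightarrow> (nat \<Rightarrow> ((nat \<Rightarrow> 'a) \<Rightarrow> real) \<Rightarrow> real) \<Rightarrow> ((nat \<Rightarrow> 'a) \<Rightarrow> real) \<Rightarrow> ennreal" where
  "limit_norm X m h =
     Inf {limit_norm_lsc X m g | g.
            lower_semicontinuous (product_space X) g \<and> (\<forall>x\<in>Pi\<^sub>E UNIV X. \<bar>h x\<bar> \<le> g x)}"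

definition derived_submeasure :: "(('x \<Rightarrow> real) \<Rightarrow> ennreal) \<Rightarrow> 'x set \<Rightarrow> ennreal" where
  "derived_submeasure k A = k (indicator A)"

definition Polish_space :: "'x topology \<Rightarrow> bool" where
  "Polish_space T \<longleftrightarrow> completely_metrizable_space T \<and> separable_space T"

definition capacity_on :: "'x topology \<Rightarrow> ('x set \<Rightarrow> ennreal) \<Rightarrow> bool" where
  "capacity_on T c \<longleftrightarrow>
     Polish_space T \<and>
     c {} = 0 \<and>
     (\<forall>A B. A \<subseteq> B \<and> B \<subseteq> topspace T \<longrightarrow> c A \<le> c B) \<and>
     (\<forall>A B. A \<subseteq> topspace T \<and> B \<subseteq> topspace T \<longrightarrow> c (A \<union> B) \<le> c A + c B) \<and>
     (\<forall>A :: nat \<Rightarrow> 'x set. (\<forall>i. A i \<subseteq> topspace T) \<and> incseq A \<longrightarrow> c (\<Union>i. A i) = (SUP i. c (A i))) \<and>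
     (\<forall>K. compactin T K \<longrightarrow> c K < \<infinity>)"

definition outer_regular :: "'x topology \<Rightarrow> ('x set \<Rightarrow> ennreal) \<Rightarrow> bool" where
  "outer_regular T c \<longleftrightarrow> (\<forall>A\<subseteq>topspace T. c A = Inf {c U | U. openin T U \<and> A \<subseteq> U})"

definition stable_capacity :: "'x topology \<Rightarrow> ('x set \<Rightarrow> ennreal) \<Rightarrow> bool" where
  "stable_capacity T c \<longleftrightarrow>
     (\<forall>A. openin T A \<longrightarrow>
        (\<exists>A' \<in> sigma_sets (topspace T) {U. openin T U}.
           A \<subseteq> A' \<and> c A' = c A \<and>
           (\<forall>B. B \<subseteq> topspace T - A' \<and> 0 < c B \<longrightarrow> c A < c (A \<union> B))))"

end

theory Submission
  imports Defs
begin

text \<open>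
  Call \<open>g\<close> on the tree of finite sequences a supermartingale if \<open>n\<^sub>i (a \<mapsto> g (s a)) \<le> g s\<close>
  at each node \<open>s\<close> of length \<open>i\<close>. The capacity of \<open>A\<close> is the least starting value of a
  supermartingale that reaches 1 along every branch in \<open>A\<close>; starting at a node \<open>s\<close> instead of the
  root gives a conditional capacity \<open>c\<^sub>s(A)\<close>, and optional stopping shows that \<open>s \<mapsto> c\<^sub>s(A)\<close> is a
  martingale.

  Two facts drive everything. The maximal inequality bounds the capacity of
  \<open>{x. \<exists>j. c\<^bsub>x|j\<^esub>(A) \<ge> \<theta>}\<close> by \<open>c(A) / \<theta>\<close>. The density theorem says that a set \<open>B\<close> with
  \<open>c\<^sub>s(B) \<le> \<theta> < 1\<close> at all nodes is null, because \<open>\<theta> g\<close> dominates \<open>c(B)\<close> for each competitor \<open>g\<close>.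
  For increasing \<open>A\<^sub>i\<close>, the supremum of the martingales \<open>c\<^sub>s(A\<^sub>i)\<close> is a supermartingale that exceeds
  \<open>\<theta>\<close> on all of \<open>\<Union>A\<^sub>i\<close> up to a null set, which gives continuity from below. For stability,
  \<open>A'\<close> adds to \<open>A\<close> the points where \<open>c\<^bsub>x|j\<^esub>(A)\<close> comes arbitrarily close to 1; a non-null \<open>B\<close>
  outside \<open>A'\<close> has a node with \<open>c\<^sub>s(B) > \<theta> \<ge> c\<^sub>s(A)\<close>, and strict monotonicity of the norms carries
  the strict inequality \<open>c\<^sub>s(A) < c\<^sub>s(A \<union> B)\<close> down to the root.
\<close>

section \<open>Good norms\<close>

lemma good_norm_nonneg: "good_norm Y m \<Longrightarrow> 0 \<le> m f"
  by (simp add: good_norm_def norm_on_def)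

lemma good_norm_mono_abs: "good_norm Y m \<Longrightarrow> (\<And>y. y \<in> Y \<Longrightarrow> \<bar>f y\<bar> \<le> \<bar>g y\<bar>) \<Longrightarrow> m f \<le> m g"
  by (simp add: good_norm_def)

lemma good_norm_mono:
  "good_norm Y m \<Longrightarrow> (\<And>y. y \<in> Y \<Longrightarrow> 0 \<le> f y) \<Longrightarrow> (\<And>y. y \<in> Y \<Longrightarrow> f y \<le> g y) \<Longrightarrow> m f \<le> m g"
  by (erule good_norm_mono_abs) force

lemma good_norm_strict_mono:
  assumes "good_norm Y m" "finite Y" "\<And>y. y \<in> Y \<Longrightarrow> 0 \<le> f y" "\<And>y. y \<in> Y \<Longrightarrow> f y \<le> g y"
    and "z \<in> Y" "f z < g z"
  shows "m f < m g"
proof -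
  have "\<forall>y\<in>Y. \<bar>f y\<bar> \<le> \<bar>g y\<bar>" using assms(3,4) by force
  moreover have "\<exists>y\<in>Y. \<bar>f y\<bar> \<noteq> \<bar>g y\<bar>" using assms(3)[OF assms(5)] assms(5,6) by force
  ultimately show ?thesis using assms(1,2) unfolding good_norm_def by blast
qed

lemma good_norm_cong: "good_norm Y m \<Longrightarrow> (\<And>y. y \<in> Y \<Longrightarrow> f y = g y) \<Longrightarrow> m f = m g"
  by (rule antisym; erule good_norm_mono_abs) auto

lemma good_norm_scale: "good_norm Y m \<Longrightarrow> m (\<lambda>y. a * f y) = \<bar>a\<bar> * m f"
  by (simp add: good_norm_def norm_on_def)

lemma good_norm_const: "good_norm Y m \<Longrightarrow> m (\<lambda>_. a) = \<bar>a\<bar>"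
  using good_norm_scale[of Y m a "\<lambda>_. 1"] by (simp add: good_norm_def)

lemma good_norm_add: "good_norm Y m \<Longrightarrow> m (\<lambda>y. f y + g y) \<le> m f + m g"
  by (simp add: good_norm_def norm_on_def)

lemma good_norm_add_const: "good_norm Y m \<Longrightarrow> 0 \<le> e \<Longrightarrow> m (\<lambda>y. f y + e) \<le> m f + e"
  using good_norm_add[of Y m f "\<lambda>_. e"] good_norm_const[of Y m e] by simp

text \<open>On a finite set a good norm is bounded by the sum of absolute values, hence Lipschitz
  for that sum and continuous under pointwise convergence. This lets series and suprema of
  supermartingales pass through \<open>n i\<close>.\<close>

lemma good_norm_tendsto:
  assumes m: "good_norm Y m" and Y: "finite Y"
    and F: "\<And>y. y \<in> Y \<Longrightarrow> (\<lambda>k. F k y) \<longlonglongrightarrow> G y"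
  shows "(\<lambda>k. m (F k)) \<longlonglongrightarrow> m G"
proof -
  have bound: "m f \<le> (\<Sum>y\<in>Y. \<bar>f y\<bar>)" for f
  proof -
    have "m f \<le> m (\<lambda>_. \<Sum>y\<in>Y. \<bar>f y\<bar>)"
      by (rule good_norm_mono_abs[OF m]) (use Y in \<open>auto intro: member_le_sum order_trans[OF _ abs_ge_self]\<close>)
    also have "\<dots> = (\<Sum>y\<in>Y. \<bar>f y\<bar>)"
      by (subst good_norm_const[OF m]) (simp add: sum_nonneg)
    finally show ?thesis .
  qed
  have sub: "m f - m g \<le> m (\<lambda>y. f y - g y)" for f g
    using good_norm_add[OF m, of "\<lambda>y. f y - g y" g] by simp
  have sym: "m (\<lambda>y. f y - g y) = m (\<lambda>y. g y - f y)" for f g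
    using good_norm_scale[OF m, of "-1" "\<lambda>y. f y - g y"] by simp
  have diff: "\<bar>m (F k) - m G\<bar> \<le> (\<Sum>y\<in>Y. \<bar>F k y - G y\<bar>)" for k
    using sub[of "F k" G] sub[of G "F k"] sym[of G "F k"] bound[of "\<lambda>y. F k y - G y"] by linarith
  have "(\<lambda>k. \<Sum>y\<in>Y. \<bar>F k y - G y\<bar>) \<longlonglongrightarrow> 0"
  proof (rule tendsto_null_sum)
    fix y assume "y \<in> Y"
    from F[OF this] show "(\<lambda>k. \<bar>F k y - G y\<bar>) \<longlonglongrightarrow> 0"
      by (simp add: LIM_zero tendsto_rabs_zero)
  qed
  then have "(\<lambda>k. m (F k) - m G) \<longlonglongrightarrow> 0"
    by (rule Lim_null_comparison[rotated]) (simp add: always_eventually diff)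
  then show ?thesis by (rule LIM_zero_cancel)
qed

text \<open>The factors 1 - 1/(k + 2) are at least 1/2 and tend to 1, so they serve below as
  positive thresholds \<theta> < 1. Since \<open>c\<close> is at most 1, the error is at most 1/(k +
  2).\<close>

lemma le_of_mult_le:
  fixes c r :: real
  assumes "c \<le> 1" "\<And>k. (1 - 1 / (real k + 2)) * c \<le> r"
  shows "c \<le> r"
proof (rule field_le_epsilon)
  fix e :: real assume "0 < e"
  then obtain k where "inverse (real (Suc k)) < e" using reals_Archimedean by blast
  moreover have "1 / (real k + 2) \<le> inverse (real (Suc k))" by (simp add: field_simps)
  moreover have "c * (1 / (real k + 2)) \<le> 1 * (1 / (real k + 2))"
    by (rule mult_right_mono) (use assms(1) in auto)
  ultimately show "c \<le> r + e" using assms(2)[of k] by (simp add: algebra_simps)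
qed

section \<open>Finite prefixes of branches\<close>

definition prefix_of :: "(nat \<Rightarrow> 'a) \<Rightarrow> nat \<Rightarrow> 'a list" where
  "prefix_of x j = map x [0..<j]"

lemma length_prefix_of [simp]: "length (prefix_of x j) = j"
  by (simp add: prefix_of_def)

lemma prefix_of_0 [simp]: "prefix_of x 0 = []"
  by (simp add: prefix_of_def)

lemma prefix_of_Suc: "prefix_of x (Suc j) = prefix_of x j @ [x j]"
  by (simp add: prefix_of_def)

lemma take_prefix_of [simp]: "take k (prefix_of x j) = prefix_of x (min k j)"
  by (auto simp: prefix_of_def take_map min_def)

lemma prefix_of_eq_iff: "prefix_of x j = prefix_of y j \<longleftrightarrow> (\<forall>i<j. x i = y i)"
  by (auto simp: prefix_of_def)

section \<open>Supermartingales and conditional capacities\<close>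

locale good_norm_sequence =
  fixes X :: "nat \<Rightarrow> 'a set" and n :: "nat \<Rightarrow> ('a \<Rightarrow> real) \<Rightarrow> real"
  assumes finite_X: "finite (X i)"
    and nonempty_X: "X i \<noteq> {}"
    and good: "good_norm (X i) (n i)"
begin

text \<open>The step inequality is demanded at all lists extending \<open>s\<close>, legal or not,
  but \<open>n i\<close> reads only those \<open>a\<close> that lie in \<open>X i\<close>. Values at
  lists with illegal entries are thus a matter of convention, and 0 is always admissible
  there.\<close>

definition supermartingale :: "'a list \<Rightarrow> ('a list \<Rightarrow> real) \<Rightarrow> bool" where
  "supermartingale s g \<longleftrightarrow>
     (\<forall>u. 0 \<le> g u) \<and> (\<forall>t. n (length (s @ t)) (\<lambda>a. g (s @ t @ [a])) \<le> g (s @ t))"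

text \<open>The value 1 must be reached at a finite stage, which a prefix already decides, so the
  branches in the product on which \<open>g\<close> reaches 1 form an open set. Outer regularity
  comes from this.\<close>

definition captures :: "(nat \<Rightarrow> 'a) set \<Rightarrow> 'a list \<Rightarrow> ('a list \<Rightarrow> real) \<Rightarrow> bool" where
  "captures A s g \<longleftrightarrow> supermartingale s g \<and>
     (\<forall>x\<in>A. prefix_of x (length s) = s \<longrightarrow> (\<exists>j\<ge>length s. 1 \<le> g (prefix_of x j)))"

definition cond_cap :: "(nat \<Rightarrow> 'a) set \<Rightarrow> 'a list \<Rightarrow> real" where
  "cond_cap A s = Inf {g s | g. captures A s g}"

lemma supermartingaleI:
  assumes "\<And>u. 0 \<le> g u" "\<And>t. n (length (s @ t)) (\<lambda>a. g (s @ t @ [a])) \<le> g (s @ t)"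
  shows "supermartingale s g"
  using assms by (simp add: supermartingale_def)

lemma supermartingale_nonneg: "supermartingale s g \<Longrightarrow> 0 \<le> g u"
  by (simp add: supermartingale_def)

lemma supermartingale_step:
  "supermartingale s g \<Longrightarrow> n (length (s @ t)) (\<lambda>a. g (s @ t @ [a])) \<le> g (s @ t)"
  by (simp add: supermartingale_def)

lemma supermartingale_extend:
  assumes "supermartingale s g"
  shows "supermartingale (s @ t) g"
proof (rule supermartingaleI)
  show "n (length ((s @ t) @ v)) (\<lambda>a. g ((s @ t) @ v @ [a])) \<le> g ((s @ t) @ v)" for v
    using supermartingale_step[OF assms, of "t @ v"] by simp
qed (rule supermartingale_nonneg[OF assms])

lemma supermartingale_const: "0 \<le> a \<Longrightarrow> supermartingale s (\<lambda>_. a)"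
  by (rule supermartingaleI) (auto simp: good_norm_const[OF good])

lemma supermartingale_scale:
  "supermartingale s g \<Longrightarrow> 0 \<le> a \<Longrightarrow> supermartingale s (\<lambda>u. a * g u)"
  by (auto simp: supermartingale_def good_norm_scale[OF good] intro: mult_left_mono)

lemma supermartingale_add:
  assumes "supermartingale s g" "supermartingale s h"
  shows "supermartingale s (\<lambda>u. g u + h u)"
proof (rule supermartingaleI)
  show "n (length (s @ t)) (\<lambda>a. g (s @ t @ [a]) + h (s @ t @ [a])) \<le> g (s @ t) + h (s @ t)" for t
    by (rule order_trans[OF good_norm_add[OF good]])
      (intro add_mono supermartingale_step assms)
qed (use assms in \<open>simp add: supermartingale_nonneg\<close>)

lemma captures_supermartingale: "captures A s g \<Longrightarrow> supermartingale s g"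
  by (simp add: captures_def)

lemma captures_reaches:
  "captures A s g \<Longrightarrow> x \<in> A \<Longrightarrow> prefix_of x (length s) = s \<Longrightarrow> \<exists>j\<ge>length s. 1 \<le> g (prefix_of x j)"
  by (simp add: captures_def)

lemma captures_one: "captures A s (\<lambda>_. 1)"
  by (auto simp: captures_def supermartingale_const)

lemma bdd_below_captures: "bdd_below {g s | g. captures A s g}"
  by (rule bdd_belowI[of _ 0]) (auto simp: captures_def supermartingale_nonneg)

lemma cond_cap_le: "captures A s g \<Longrightarrow> cond_cap A s \<le> g s"
  unfolding cond_cap_def by (intro cInf_lower bdd_below_captures) auto

lemma cond_cap_greatest: "(\<And>g. captures A s g \<Longrightarrow> r \<le> g s) \<Longrightarrow> r \<le> cond_cap A s"
  unfolding cond_cap_def by (rule cInf_greatest) (use captures_one in auto)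

lemma cond_cap_approx: "0 < e \<Longrightarrow> \<exists>g. captures A s g \<and> g s < cond_cap A s + e"
  using cond_cap_greatest[of A s "cond_cap A s + e"] by force

lemma cond_cap_nonneg: "0 \<le> cond_cap A s"
  by (rule cond_cap_greatest) (auto simp: captures_def supermartingale_nonneg)

lemma cond_cap_le_1: "cond_cap A s \<le> 1"
  using cond_cap_le[OF captures_one] .

lemma cond_cap_mono: "A \<subseteq> B \<Longrightarrow> cond_cap A s \<le> cond_cap B s"
  by (rule cond_cap_greatest, rule cond_cap_le) (auto simp: captures_def)

lemma cond_cap_eq_0:
  assumes "\<And>x. x \<in> A \<Longrightarrow> prefix_of x (length s) \<noteq> s"
  shows "cond_cap A s = 0"
proof -
  have "captures A s (\<lambda>_. 0)" using assms by (auto simp: captures_def supermartingale_const)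
  from cond_cap_le[OF this] cond_cap_nonneg[of A s] show ?thesis by simp
qed

lemma cond_cap_Un: "cond_cap (A \<union> B) s \<le> cond_cap A s + cond_cap B s"
proof (rule field_le_epsilon)
  fix e :: real assume "0 < e"
  then obtain g h where g: "captures A s g" "g s < cond_cap A s + e/2"
    and h: "captures B s h" "h s < cond_cap B s + e/2"
    using cond_cap_approx[of "e/2"] by (metis half_gt_zero)
  have "captures (A \<union> B) s (\<lambda>u. g u + h u)"
    unfolding captures_def
  proof (intro conjI ballI impI)
    show "supermartingale s (\<lambda>u. g u + h u)"
      using g h by (simp add: captures_supermartingale supermartingale_add)
    fix x assume "x \<in> A \<union> B" "prefix_of x (length s) = s"
    then obtain j where "j \<ge> length s" "1 \<le> g (prefix_of x j) \<or> 1 \<le> h (prefix_of x j)"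
      using captures_reaches[OF g(1)] captures_reaches[OF h(1)] by blast
    moreover have "0 \<le> g (prefix_of x j)" "0 \<le> h (prefix_of x j)"
      using g(1) h(1) by (auto simp: captures_def supermartingale_nonneg)
    ultimately show "\<exists>j\<ge>length s. 1 \<le> g (prefix_of x j) + h (prefix_of x j)"
      by (intro exI[of _ j]) auto
  qed
  from cond_cap_le[OF this] g(2) h(2)
  show "cond_cap (A \<union> B) s \<le> cond_cap A s + cond_cap B s + e" by simp
qed

text \<open>Optional stopping: follow \<open>W\<close> until it dominates \<open>cond_cap A\<close>, then switch to a nearly
  optimal supermartingale for the node reached.\<close>

lemma cond_cap_le_supermartingale:
  assumes W: "supermartingale s W"
    and reach: "\<And>x. x \<in> A \<Longrightarrow> prefix_of x (length s) = s \<Longrightarrow>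
      \<exists>j\<ge>length s. cond_cap A (prefix_of x j) \<le> W (prefix_of x j)"
  shows "cond_cap A s \<le> W s"
proof (rule field_le_epsilon)
  fix e :: real assume e: "0 < e"
  obtain G where G: "\<And>u. captures A u (G u)" "\<And>u. G u u < cond_cap A u + e"
    using cond_cap_approx[OF e] by metis
  \<comment> \<open>\<open>P u k\<close> marks the nodes on the way to \<open>u\<close>, from
    \<open>s\<close> on, where switching is allowed. \<open>U\<close> switches at the first of them;
    before that, the margin \<open>e\<close> added to \<open>W\<close> pays for the excess of
    \<open>G\<close> over the conditional capacity at the switch.\<close>
  define P where "P u k \<longleftrightarrow> length s \<le> k \<and> k \<le> length u \<and> cond_cap A (take k u) \<le> W (take k u)" for u k
  define U where "U u = (if \<exists>k. P u k then G (take (LEAST k. P u k) u) u else W u + e)" for u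
  have stopped: "U u = G (take k u) u" if "P u k" "\<And>i. i < k \<Longrightarrow> \<not> P u i" for u k
  proof -
    have "(LEAST k. P u k) = k" using that by (meson LeastI not_less_Least linorder_neqE_nat)
    then show ?thesis using that by (auto simp: U_def)
  qed
  have first: "U u \<le> W u + e" if "\<And>i. i < length u \<Longrightarrow> \<not> P u i" for u
  proof (cases "P u (length u)")
    case True
    then have "U u = G u u" using stopped[OF True] that by simp
    also have "\<dots> \<le> cond_cap A u + e" using G(2)[of u] by simp
    also have "\<dots> \<le> W u + e" using True by (simp add: P_def)
    finally show ?thesis .
  next
    case False
    then have "\<not> (\<exists>k. P u k)" using that by (metis P_def le_neq_implies_less)
    then show ?thesis by (simp add: U_def)
  qed
  have U0: "0 \<le> U u" for u
    using supermartingale_nonneg[OF captures_supermartingale[OF G(1)]] supermartingale_nonneg[OF W] e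
    by (auto simp: U_def add_nonneg_pos less_imp_le)
  have "captures A s U"
    unfolding captures_def
  proof (intro conjI ballI impI)
    show "supermartingale s U"
    proof (rule supermartingaleI)
      fix t
      let ?u = "s @ t"
      show "n (length ?u) (\<lambda>a. U (s @ t @ [a])) \<le> U ?u"
      proof (cases "\<exists>k. P ?u k")
        case True
        define k where "k = (LEAST k. P ?u k)"
        have k: "P ?u k" "\<And>i. i < k \<Longrightarrow> \<not> P ?u i"
          using True not_less_Least unfolding k_def by (auto intro: LeastI)
        have kl: "length s \<le> k" "k \<le> length ?u" using k(1) by (auto simp: P_def)
        \<comment> \<open>After the switch all children keep the same switching node, so
          \<open>U\<close> moves along one fixed supermartingale.\<close>
        have "U (?u @ [a]) = G (take k ?u) (?u @ [a])" for a
        proof -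
          have "P (?u @ [a]) k" using k(1) by (auto simp: P_def)
          moreover have "\<not> P (?u @ [a]) i" if "i < k" for i
            using k(2)[OF that] that kl unfolding P_def by simp
          ultimately have "U (?u @ [a]) = G (take k (?u @ [a])) (?u @ [a])" by (rule stopped)
          then show ?thesis using kl(2) by simp
        qed
        then have "n (length ?u) (\<lambda>a. U (s @ t @ [a])) = n (length ?u) (\<lambda>a. G (take k ?u) (?u @ [a]))"
          by simp
        also have "\<dots> \<le> G (take k ?u) ?u"
          using supermartingale_step[OF captures_supermartingale[OF G(1)[of "take k ?u"]], of "drop k ?u"]
          by (simp only: append_assoc[symmetric] append_take_drop_id)
        also have "\<dots> = U ?u" using stopped[OF k] by simp
        finally show ?thesis .
      next
        case False
        \<comment> \<open>No switch has occurred at \<open>?u\<close>, so a child can only switch at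
          its own full length, the situation covered by \<open>first\<close>.\<close>
        have "n (length ?u) (\<lambda>a. U (s @ t @ [a])) \<le> n (length ?u) (\<lambda>a. W (s @ t @ [a]) + e)"
        proof (rule good_norm_mono[OF good U0])
          fix a
          have "\<not> P (?u @ [a]) i" if "i < length (?u @ [a])" for i
            using False that by (auto simp: P_def)
          from first[OF this] show "U (s @ t @ [a]) \<le> W (s @ t @ [a]) + e" by simp
        qed
        also have "\<dots> \<le> W ?u + e"
          using good_norm_add_const[OF good, of e] supermartingale_step[OF W, of t] e
          by (meson add_right_mono less_imp_le order_trans)
        also have "\<dots> = U ?u" using False by (simp add: U_def)
        finally show ?thesis .
      qed
    qed (rule U0)
    fix x assume x: "x \<in> A" "prefix_of x (length s) = s"
    define Q where "Q k \<longleftrightarrow> length s \<le> k \<and> cond_cap A (prefix_of x k) \<le> W (prefix_of x k)" for k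
    define k where "k = (LEAST k. Q k)"
    have "\<exists>k. Q k" using reach[OF x] by (auto simp: Q_def)
    then have k: "Q k" "\<And>i. i < k \<Longrightarrow> \<not> Q i"
      using not_less_Least unfolding k_def by (auto intro: LeastI)
    obtain j where j: "j \<ge> k" "1 \<le> G (prefix_of x k) (prefix_of x j)"
      using captures_reaches[OF G(1) x(1), of "prefix_of x k"] by auto
    \<comment> \<open>The switching condition along \<open>x\<close> does not depend on the length
      of the prefix, so every prefix of length at least \<open>k\<close> has its first switch at
      \<open>k\<close>.\<close>
    have PQ: "P (prefix_of x j) i \<longleftrightarrow> Q i \<and> i \<le> j" for i
      by (auto simp: P_def Q_def min_def)
    have "U (prefix_of x j) = G (take k (prefix_of x j)) (prefix_of x j)"
      by (rule stopped) (use k j in \<open>auto simp: PQ\<close>)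
    then show "\<exists>j\<ge>length s. 1 \<le> U (prefix_of x j)"
      using j k(1) by (intro exI[of _ j]) (auto simp: Q_def min_def)
  qed
  then have "cond_cap A s \<le> U s" by (rule cond_cap_le)
  also have "\<dots> \<le> W s + e" by (rule first) (auto simp: P_def)
  finally show "cond_cap A s \<le> W s + e" .
qed

text \<open>Upper bound: a competitor \<open>g\<close> with \<open>g s < 1\<close> captures no
  branch at \<open>s\<close> itself, so it still competes at every child. Lower bound: optional
  stopping after one step, where the process to be followed already equals the conditional
  capacity.\<close>

lemma cond_cap_martingale: "n (length s) (\<lambda>a. cond_cap A (s @ [a])) = cond_cap A s"
proof (rule antisym)
  show le: "n (length s) (\<lambda>a. cond_cap A (s @ [a])) \<le> cond_cap A s" for s
  proof (rule cond_cap_greatest)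
    fix g assume g: "captures A s g"
    show "n (length s) (\<lambda>a. cond_cap A (s @ [a])) \<le> g s"
    proof (cases "1 \<le> g s")
      case True
      have "n (length s) (\<lambda>a. cond_cap A (s @ [a])) \<le> n (length s) (\<lambda>_. 1)"
        by (rule good_norm_mono[OF good cond_cap_nonneg cond_cap_le_1])
      with True show ?thesis by (simp add: good_norm_const[OF good])
    next
      case False
      have "n (length s) (\<lambda>a. cond_cap A (s @ [a])) \<le> n (length s) (\<lambda>a. g (s @ [a]))"
      proof (rule good_norm_mono[OF good cond_cap_nonneg], rule cond_cap_le)
        fix a
        show "captures A (s @ [a]) g"
          unfolding captures_def
        proof (intro conjI ballI impI)
          show "supermartingale (s @ [a]) g"
            using g by (simp add: captures_supermartingale supermartingale_extend)
          fix x assume x: "x \<in> A" "prefix_of x (length (s @ [a])) = s @ [a]"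
          then have p: "prefix_of x (length s) = s" by (simp add: prefix_of_Suc)
          then obtain j where j: "j \<ge> length s" "1 \<le> g (prefix_of x j)"
            using captures_reaches[OF g x(1)] by auto
          with p False have "j \<noteq> length s" by auto
          with j show "\<exists>j\<ge>length (s @ [a]). 1 \<le> g (prefix_of x j)" by (intro exI[of _ j]) auto
        qed
      qed
      also have "\<dots> \<le> g s" 
        using supermartingale_step[OF captures_supermartingale[OF g], of "[]"] by simp
      finally show ?thesis .
    qed
  qed
  \<comment> \<open>Only the value at \<open>s\<close> is changed, and by \<open>le\<close> it can
    only drop. The step inequality at the proper descendants of \<open>s\<close> is
    \<open>le\<close> again, which is why \<open>le\<close> is proved for all nodes.\<close>
  define W where "W u = (if u = s then n (length s) (\<lambda>a. cond_cap A (s @ [a])) else cond_cap A u)" for u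
  have "cond_cap A s \<le> W s"
  proof (rule cond_cap_le_supermartingale)
    show "supermartingale s W"
    proof (rule supermartingaleI)
      show "0 \<le> W u" for u by (simp add: W_def cond_cap_nonneg good_norm_nonneg[OF good])
      show "n (length (s @ t)) (\<lambda>a. W (s @ t @ [a])) \<le> W (s @ t)" for t
        using le[of "s @ t"] by (auto simp: W_def)
    qed
    fix x assume "prefix_of x (length s) = s"
    have "prefix_of x (Suc (length s)) \<noteq> s" by (metis length_prefix_of n_not_Suc_n)
    then show "\<exists>j\<ge>length s. cond_cap A (prefix_of x j) \<le> W (prefix_of x j)"
      by (intro exI[of _ "Suc (length s)"]) (auto simp: W_def)
  qed
  then show "cond_cap A s \<le> n (length s) (\<lambda>a. cond_cap A (s @ [a]))" by (simp add: W_def)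
qed

lemma supermartingale_cond_cap: "supermartingale s (cond_cap A)"
proof (rule supermartingaleI)
  show "n (length (s @ t)) (\<lambda>a. cond_cap A (s @ t @ [a])) \<le> cond_cap A (s @ t)" for t
    using cond_cap_martingale[of "s @ t" A] by simp
qed (rule cond_cap_nonneg)

text \<open>Wherever a competitor \<open>g\<close> reaches 1, \<open>\<theta> * g\<close> already
  dominates the conditional capacity, so optional stopping improves the bound \<open>g s\<close> to
  \<open>\<theta> * g s\<close>. Taking the infimum over \<open>g\<close> forces the value
  0.\<close>

lemma cond_cap_null:
  assumes "\<theta> < 1" and le: "\<And>s. cond_cap A s \<le> \<theta>"
  shows "cond_cap A s = 0"
proof -
  have \<theta>: "0 \<le> \<theta>" using le[of s] cond_cap_nonneg[of A s] by simp
  have *: "cond_cap A s \<le> \<theta> * g s" if g: "captures A s g" for g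
  proof (rule cond_cap_le_supermartingale)
    show "supermartingale s (\<lambda>u. \<theta> * g u)"
      using g \<theta> by (simp add: captures_supermartingale supermartingale_scale)
    fix x assume "x \<in> A" "prefix_of x (length s) = s"
    then obtain j where "j \<ge> length s" "1 \<le> g (prefix_of x j)"
      using captures_reaches[OF g] by auto
    moreover from this have "\<theta> \<le> \<theta> * g (prefix_of x j)" using \<theta> by (simp add: mult_le_cancel_left1)
    ultimately show "\<exists>j\<ge>length s. cond_cap A (prefix_of x j) \<le> \<theta> * g (prefix_of x j)"
      using le order_trans by blast
  qed
  have "cond_cap A s \<le> \<theta> * cond_cap A s"
  proof (rule field_le_epsilon)
    fix e :: real assume e: "0 < e"
    obtain g where g: "captures A s g" "g s < cond_cap A s + e"
      using cond_cap_approx[OF e] by blast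
    have "cond_cap A s \<le> \<theta> * g s" by (rule *[OF g(1)])
    also have "\<dots> \<le> \<theta> * (cond_cap A s + e)" using g(2) \<theta> by (intro mult_left_mono) auto
    also have "\<dots> \<le> \<theta> * cond_cap A s + e"
      using assms(1) e by (simp add: distrib_left mult_le_cancel_right1)
    finally show "cond_cap A s \<le> \<theta> * cond_cap A s + e" .
  qed
  then have "(1 - \<theta>) * cond_cap A s \<le> 0" by (simp add: algebra_simps)
  with assms(1) cond_cap_nonneg[of A s] show ?thesis by (simp add: mult_le_0_iff)
qed

section \<open>Density and continuity from below\<close>

text \<open>Dividing \<open>H\<close> by \<theta> turns it into a competitor for
  \<open>A\<close>.\<close>

lemma maximal_inequality:
  assumes "supermartingale [] H" "0 < \<theta>" "\<And>x. x \<in> A \<Longrightarrow> \<exists>j. \<theta> \<le> H (prefix_of x j)"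
  shows "\<theta> * cond_cap A [] \<le> H []"
proof -
  have "captures A [] (\<lambda>u. inverse \<theta> * H u)"
    unfolding captures_def
  proof (intro conjI ballI impI)
    show "supermartingale [] (\<lambda>u. inverse \<theta> * H u)"
      using assms(1,2) by (intro supermartingale_scale) auto
    fix x assume "x \<in> A"
    then obtain j where "\<theta> \<le> H (prefix_of x j)" using assms(3) by blast
    then show "\<exists>j\<ge>length []. 1 \<le> inverse \<theta> * H (prefix_of x j)"
      using assms(2) by (intro exI[of _ j]) (simp add: field_simps)
  qed
  from cond_cap_le[OF this] assms(2) show ?thesis by (simp add: field_simps)
qed

lemma supermartingale_sum:
  "(\<And>i. supermartingale s (g i)) \<Longrightarrow> supermartingale s (\<lambda>u. \<Sum>i<k. g i u)" for k :: nat
  by (induction k) (auto simp: supermartingale_const intro: supermartingale_add)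

text \<open>Competitors with root values below e/2^(i+1) are added up; the sum captures the union
  and starts below \<open>e\<close>. It is again a supermartingale because finite sums are and the
  norms are continuous. The inclusion in the product keeps the relevant prefixes legal, where the
  series converges.\<close>

lemma cond_cap_UN_null:
  fixes A :: "nat \<Rightarrow> (nat \<Rightarrow> 'a) set"
  assumes A: "\<And>i. A i \<subseteq> Pi\<^sub>E UNIV X" and null: "\<And>i. cond_cap (A i) [] = 0"
  shows "cond_cap (\<Union>i. A i) [] = 0"
proof -
  have "cond_cap (\<Union>i. A i) [] \<le> 0 + e" if e: "0 < e" for e :: real
  proof -
    have "\<exists>g. captures (A i) [] g \<and> g [] < e * (1/2) ^ Suc i" for i
      using cond_cap_approx[of "e * (1/2) ^ Suc i" "A i" "[]"] e null by auto
    then obtain g where g: "\<And>i. captures (A i) [] (g i)" "\<And>i. g i [] < e * (1/2) ^ Suc i"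
      by metis
    have super: "supermartingale [] (g i)" for i using g(1) by (rule captures_supermartingale)
    have g0: "0 \<le> g i u" for i u by (rule supermartingale_nonneg[OF super])
    have geo: "(\<lambda>i. e * (1/2) ^ Suc i) sums e"
      using sums_mult[OF power_half_series, of e] by simp
    have root: "summable (\<lambda>i. g i [])"
      by (rule summable_comparison_test'[OF sums_summable[OF geo]])
        (use g(2) g0 in \<open>auto intro: less_imp_le\<close>)
    define valid where "valid u \<longleftrightarrow> (\<forall>i<length u. u ! i \<in> X i)" for u
    \<comment> \<open>The norm of the indicator of \<open>{a}\<close> is positive, so convergence at a node passes on to its
      children.\<close>
    have summable: "summable (\<lambda>i. g i u)" if "valid u" for u
      using that
    proof (induction u rule: rev_induct)
      case Nil
      show ?case by (rule root)
    next
      case (snoc a u)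
      have a: "a \<in> X (length u)" using snoc.prems by (auto simp: valid_def)
      have "valid u" using snoc.prems unfolding valid_def
        by (metis length_append_singleton less_SucI nth_append)
      define w where "w = n (length u) (\<lambda>b. indicator {a} b)"
      have "w \<noteq> 0"
        using good[of "length u"] a unfolding w_def good_norm_def norm_on_def by force
      then have w: "0 < w" using good_norm_nonneg[OF good] unfolding w_def by (metis less_eq_real_def)
      have "g i (u @ [a]) \<le> inverse w * g i u" for i
      proof -
        have "g i (u @ [a]) * w = n (length u) (\<lambda>b. g i (u @ [a]) * indicator {a} b)"
          by (simp add: w_def good_norm_scale[OF good] g0)
        also have "\<dots> \<le> n (length u) (\<lambda>b. g i (u @ [b]))"
          by (rule good_norm_mono[OF good]) (auto simp: g0 indicator_def)
        also have "\<dots> \<le> g i u" using supermartingale_step[OF super, of u] by simp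
        finally show ?thesis using w by (simp add: field_simps)
      qed
      then show ?case
        by (intro summable_comparison_test'[OF summable_mult[OF snoc.IH[OF \<open>valid u\<close>]], of _ _ "inverse w"])
          (auto simp: g0)
    qed
    \<comment> \<open>Convergence is known only at legal nodes. The value 0 elsewhere is harmless:
      children of an illegal node are illegal, and at a legal node the norm does not see illegal
      children.\<close>
    define S where "S u = (if valid u then \<Sum>i. g i u else 0)" for u
    have "captures (\<Union>i. A i) [] S"
      unfolding captures_def
    proof (intro conjI ballI impI)
      show "supermartingale [] S"
      proof (rule supermartingaleI)
        show "0 \<le> S u" for u by (auto simp: S_def g0 intro: suminf_nonneg summable)
        fix u
        show "n (length ([] @ u)) (\<lambda>a. S ([] @ u @ [a])) \<le> S ([] @ u)"
        proof (cases "valid u")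
          case True
          have "(\<lambda>k. n (length u) (\<lambda>a. \<Sum>i<k. g i (u @ [a]))) \<longlonglongrightarrow> n (length u) (\<lambda>a. S (u @ [a]))"
          proof (rule good_norm_tendsto[OF good finite_X])
            fix a assume "a \<in> X (length u)"
            then have "valid (u @ [a])" using True by (auto simp: valid_def nth_append less_Suc_eq)
            then show "(\<lambda>k. \<Sum>i<k. g i (u @ [a])) \<longlonglongrightarrow> S (u @ [a])"
              by (simp add: S_def summable summable_LIMSEQ)
          qed
          moreover have "n (length u) (\<lambda>a. \<Sum>i<k. g i (u @ [a])) \<le> S u" for k
          proof -
            have "n (length u) (\<lambda>a. \<Sum>i<k. g i (u @ [a])) \<le> (\<Sum>i<k. g i u)"
              using supermartingale_step[OF supermartingale_sum[of "[]" g k, OF super], of u] by simp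
            also have "\<dots> \<le> S u"
              using True by (simp add: S_def sum_le_suminf summable g0)
            finally show ?thesis .
          qed
          ultimately show ?thesis by (auto intro: LIMSEQ_le_const2)
        next
          case False
          then have "\<not> valid (u @ [a])" for a unfolding valid_def
            by (metis length_append_singleton less_SucI nth_append)
          then show ?thesis using False by (simp add: S_def good_norm_const[OF good])
        qed
      qed
      fix x assume "x \<in> (\<Union>i. A i)"
      then obtain i where i: "x \<in> A i" by blast
      obtain j where j: "1 \<le> g i (prefix_of x j)" using captures_reaches[OF g(1) i] by auto
      have v: "valid (prefix_of x j)" using i A by (force simp: valid_def prefix_of_def PiE_iff)
      have "g i (prefix_of x j) \<le> S (prefix_of x j)"
        using v sum_le_suminf[OF summable[OF v], of "{i}"] by (simp add: S_def g0)
      with j show "\<exists>j\<ge>length []. 1 \<le> S (prefix_of x j)" by (intro exI[of _ j]) auto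
    qed
    then have "cond_cap (\<Union>i. A i) [] \<le> S []" by (rule cond_cap_le)
    also have "\<dots> = (\<Sum>i. g i [])" by (simp add: S_def valid_def)
    also have "\<dots> \<le> (\<Sum>i. e * (1/2) ^ Suc i)"
      by (rule suminf_le[OF less_imp_le[OF g(2)] root sums_summable[OF geo]])
    also have "\<dots> = e" using geo by (simp add: sums_iff)
    finally show ?thesis by simp
  qed
  then have "cond_cap (\<Union>i. A i) [] \<le> 0" by (rule field_le_epsilon)
  with cond_cap_nonneg[of "\<Union>i. A i" "[]"] show ?thesis by simp
qed

text \<open>Nodes on a branch of \<open>B\<close> inherit the bound from \<open>A\<close> by
  monotonicity, and all other nodes give \<open>B\<close> capacity 0. The density theorem
  \<open>cond_cap_null\<close> therefore applies to \<open>B\<close>.\<close>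

lemma cond_cap_low_density:
  assumes "B \<subseteq> A" "\<theta> < 1" "\<And>x j. x \<in> B \<Longrightarrow> cond_cap A (prefix_of x j) \<le> \<theta>"
  shows "cond_cap B s = 0"
proof (rule cond_cap_null)
  \<comment> \<open>When \<open>B\<close> is empty, \<theta> may be negative; the maximum keeps the
    bound true in that case.\<close>
  show "cond_cap B s \<le> max \<theta> 0" for s
  proof (cases "\<exists>x\<in>B. prefix_of x (length s) = s")
    case True
    then obtain x where "x \<in> B" "prefix_of x (length s) = s" by blast
    with assms(3)[of x "length s"] cond_cap_mono[OF assms(1), of s] show ?thesis by simp
  next
    case False
    then have "cond_cap B s = 0" by (intro cond_cap_eq_0) blast
    then show ?thesis by simp
  qed
qed (use assms(2) in simp)

text \<open>The limit \<open>H\<close> of the increasing martingales is a supermartingale by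
  continuity of the norms. Up to a null set it exceeds \<theta> somewhere along every branch of the
  union, so the maximal inequality bounds the union by \<open>r\<close> divided by \<theta>.\<close>

lemma cond_cap_UN_le:
  fixes A :: "nat \<Rightarrow> (nat \<Rightarrow> 'a) set"
  assumes A: "\<And>i. A i \<subseteq> Pi\<^sub>E UNIV X" and inc: "incseq A" and r: "\<And>i. cond_cap (A i) [] \<le> r"
  shows "cond_cap (\<Union>i. A i) [] \<le> r"
proof (rule le_of_mult_le[OF cond_cap_le_1])
  fix k
  define \<theta> where "\<theta> = 1 - 1 / (real k + 2)"
  have \<theta>: "0 < \<theta>" "\<theta> < 1" by (simp_all add: \<theta>_def field_simps)
  define H where "H u = (SUP i. cond_cap (A i) u)" for u
  have bdd: "bdd_above (range (\<lambda>i. cond_cap (A i) u))" for u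
    by (rule bdd_aboveI[of _ 1]) (auto simp: cond_cap_le_1)
  have le_H: "cond_cap (A i) u \<le> H u" for i u
    unfolding H_def by (rule cSUP_upper[OF _ bdd]) simp
  have lim: "(\<lambda>i. cond_cap (A i) u) \<longlonglongrightarrow> H u" for u
    unfolding H_def
    by (rule LIMSEQ_incseq_SUP[OF bdd]) (use inc in \<open>auto simp: incseq_def intro: cond_cap_mono\<close>)
  have H: "supermartingale [] H"
  proof (rule supermartingaleI)
    show "0 \<le> H u" for u using le_H[of 0 u] cond_cap_nonneg[of "A 0" u] by linarith
    fix u
    have "(\<lambda>i. n (length u) (\<lambda>a. cond_cap (A i) (u @ [a]))) \<longlonglongrightarrow> n (length u) (\<lambda>a. H (u @ [a]))"
      by (rule good_norm_tendsto[OF good finite_X lim])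
    moreover have "n (length u) (\<lambda>a. cond_cap (A i) (u @ [a])) \<le> H u" for i
      using le_H[of i u] by (simp add: cond_cap_martingale)
    ultimately show "n (length ([] @ u)) (\<lambda>a. H ([] @ u @ [a])) \<le> H ([] @ u)"
      by (auto intro: LIMSEQ_le_const2)
  qed
  define D where "D = {x. \<exists>j. \<theta> \<le> H (prefix_of x j)}"
  \<comment> \<open>A branch of \<open>A i\<close> outside \<open>N i\<close> pushes
    \<open>H\<close> above \<theta>, while \<open>N i\<close> itself is null by low density.\<close>
  define N where "N i = {x \<in> A i. \<forall>j. cond_cap (A i) (prefix_of x j) \<le> \<theta>}" for i
  have "cond_cap (N i) [] = 0" for i
    by (rule cond_cap_low_density[of _ "A i" \<theta>]) (auto simp: N_def \<theta>)
  then have "cond_cap (\<Union>i. N i) [] = 0"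
    by (rule cond_cap_UN_null[rotated]) (use A in \<open>auto simp: N_def\<close>)
  moreover have "(\<Union>i. A i) \<subseteq> D \<union> (\<Union>i. N i)"
  proof
    fix x assume "x \<in> (\<Union>i. A i)"
    then obtain i where i: "x \<in> A i" by blast
    show "x \<in> D \<union> (\<Union>i. N i)"
    proof (cases "x \<in> N i")
      case False
      then obtain j where "\<theta> < cond_cap (A i) (prefix_of x j)" using i by (auto simp: N_def not_le)
      with le_H[of i] have "\<theta> \<le> H (prefix_of x j)" by (meson less_imp_le order_trans)
      then show ?thesis by (auto simp: D_def)
    qed auto
  qed
  ultimately have "cond_cap (\<Union>i. A i) [] \<le> cond_cap D []"
    using cond_cap_mono[of "\<Union>i. A i" "D \<union> (\<Union>i. N i)" "[]"] cond_cap_Un[of D "\<Union>i. N i" "[]"] by linarith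
  then have "\<theta> * cond_cap (\<Union>i. A i) [] \<le> \<theta> * cond_cap D []" using \<theta> by simp
  also have "\<dots> \<le> H []"
    by (rule maximal_inequality[OF H \<theta>(1)]) (simp add: D_def)
  also have "\<dots> \<le> r" unfolding H_def by (rule cSUP_least) (auto simp: r)
  finally show "(1 - 1 / (real k + 2)) * cond_cap (\<Union>i. A i) [] \<le> r" by (simp add: \<theta>_def)
qed

section \<open>Density points and the envelope used for stability\<close>

definition density_points :: "(nat \<Rightarrow> 'a) set \<Rightarrow> (nat \<Rightarrow> 'a) set" where
  "density_points A =
     {x \<in> Pi\<^sub>E UNIV X. \<forall>k. \<exists>j. 1 - 1 / (real k + 2) < cond_cap A (prefix_of x j)}"

definition envelope :: "(nat \<Rightarrow> 'a) set \<Rightarrow> (nat \<Rightarrow> 'a) set" where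
  "envelope A = A \<union> density_points A"

text \<open>Conditional capacities never exceed 1, so a density point is one along which their
  supremum is 1. Elsewhere in the product one of the countably many thresholds bounds them all,
  which slices the complement into countably many pieces with uniform bounds.\<close>

lemma not_density_point:
  assumes "x \<in> Pi\<^sub>E UNIV X" "x \<notin> density_points A"
  shows "\<exists>k. \<forall>j. cond_cap A (prefix_of x j) \<le> 1 - 1 / (real k + 2)"
proof -
  have "\<not> (\<forall>k. \<exists>j. 1 - 1 / (real k + 2) < cond_cap A (prefix_of x j))"
    using assms unfolding density_points_def by blast
  then show ?thesis by (simp only: not_all not_ex not_less)
qed

text \<open>The points of \<open>A\<close> that are not density points form countably many
  low-density pieces, hence a null set. The density points cost no more than \<open>A\<close>, by
  the maximal inequality for the martingale \<open>cond_cap A\<close> with thresholds tending to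
  1.\<close>

lemma cond_cap_envelope:
  assumes "A \<subseteq> Pi\<^sub>E UNIV X"
  shows "cond_cap (envelope A) [] = cond_cap A []"
proof (rule antisym)
  define D where "D = density_points A"
  define N where "N k = {x \<in> A. \<forall>j. cond_cap A (prefix_of x j) \<le> 1 - 1 / (real k + 2)}" for k
  have "cond_cap (N k) [] = 0" for k
    by (rule cond_cap_low_density[of _ A "1 - 1 / (real k + 2)"]) (auto simp: N_def)
  then have "cond_cap (\<Union>k. N k) [] = 0"
    by (rule cond_cap_UN_null[rotated]) (use assms in \<open>auto simp: N_def\<close>)
  moreover have "envelope A \<subseteq> D \<union> (\<Union>k. N k)"
  proof -
    have "x \<in> (\<Union>k. N k)" if x: "x \<in> A" "x \<notin> D" for x
    proof -
      obtain k where "\<forall>j. cond_cap A (prefix_of x j) \<le> 1 - 1 / (real k + 2)"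
        using not_density_point[of x A] x assms unfolding D_def by blast
      then have "x \<in> N k" using x(1) by (simp add: N_def)
      then show ?thesis by blast
    qed
    moreover have "envelope A = A \<union> D" by (simp add: envelope_def D_def)
    ultimately show ?thesis by blast
  qed
  ultimately have "cond_cap (envelope A) [] \<le> cond_cap D []"
    using cond_cap_mono[of "envelope A" "D \<union> (\<Union>i. N i)" "[]"] cond_cap_Un[of D "\<Union>i. N i" "[]"] by linarith
  also have "cond_cap D [] \<le> cond_cap A []"
  proof (rule le_of_mult_le[OF cond_cap_le_1])
    fix k
    show "(1 - 1 / (real k + 2)) * cond_cap D [] \<le> cond_cap A []"
    proof (rule maximal_inequality[OF supermartingale_cond_cap])
      show "0 < 1 - 1 / (real k + 2)" by (simp add: field_simps)
      fix x assume "x \<in> D"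
      then obtain j where "1 - 1 / (real k + 2) < cond_cap A (prefix_of x j)"
        unfolding D_def density_points_def by blast
      then show "\<exists>j. 1 - 1 / (real k + 2) \<le> cond_cap A (prefix_of x j)" by (intro exI less_imp_le)
    qed
  qed
  finally show "cond_cap (envelope A) [] \<le> cond_cap A []" .
  show "cond_cap A [] \<le> cond_cap (envelope A) []"
    by (rule cond_cap_mono) (simp add: envelope_def)
qed

text \<open>By the martingale identity, strictness at one child and weak inequality at the others
  give strictness at the parent. The child must be visible to the norm, so \<open>x\<close> is taken
  in the product.\<close>

lemma cond_cap_strict_prefix:
  assumes "A \<subseteq> B" "x \<in> Pi\<^sub>E UNIV X"
  shows "cond_cap A (prefix_of x j) < cond_cap B (prefix_of x j) \<Longrightarrow> cond_cap A [] < cond_cap B []"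
proof (induction j)
  case (Suc j)
  let ?s = "prefix_of x j"
  have "n (length ?s) (\<lambda>a. cond_cap A (?s @ [a])) < n (length ?s) (\<lambda>a. cond_cap B (?s @ [a]))"
    by (rule good_norm_strict_mono[OF good finite_X, where z = "x j"])
      (use assms Suc.prems in \<open>auto simp: prefix_of_Suc PiE_iff intro: cond_cap_nonneg cond_cap_mono\<close>)
  then have "cond_cap A ?s < cond_cap B ?s" by (simp only: cond_cap_martingale)
  then show ?case by (rule Suc.IH)
qed simp

text \<open>\<open>B\<close> is cut into slices along which \<open>A\<close> has uniformly bounded
  conditional capacity. Continuity from below yields a non-null slice, and the density theorem
  yields a node where that slice exceeds the bound obeyed by \<open>A\<close>.\<close>

lemma cond_cap_envelope_strict:
  assumes B: "B \<subseteq> Pi\<^sub>E UNIV X - envelope A" and pos: "0 < cond_cap B []"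
  shows "cond_cap A [] < cond_cap (A \<union> B) []"
proof -
  define C where "C k = {x \<in> B. \<forall>j. cond_cap A (prefix_of x j) \<le> 1 - 1 / (real k + 2)}" for k
  have "incseq C"
  proof (rule incseq_SucI, rule subsetI)
    fix k x assume "x \<in> C k"
    moreover have "1 - 1 / (real k + 2) \<le> 1 - 1 / (real (Suc k) + 2)" by (simp add: field_simps)
    ultimately show "x \<in> C (Suc k)" unfolding C_def using order_trans by blast
  qed
  moreover have "B = (\<Union>k. C k)"
  proof (intro antisym subsetI)
    fix x assume x: "x \<in> B"
    then obtain k where "\<forall>j. cond_cap A (prefix_of x j) \<le> 1 - 1 / (real k + 2)"
      using not_density_point[of x A] B unfolding envelope_def by blast
    then have "x \<in> C k" using x by (simp add: C_def)
    then show "x \<in> (\<Union>k. C k)" by blast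
  qed (auto simp: C_def)
  moreover have "C k \<subseteq> Pi\<^sub>E UNIV X" for k using B by (auto simp: C_def)
  ultimately obtain k where k: "0 < cond_cap (C k) []"
    using cond_cap_UN_le[of C 0] pos by (metis not_less)
  obtain s where s: "1 - 1 / (real k + 2) < cond_cap (C k) s"
    using cond_cap_null[of "1 - 1 / (real k + 2)" "C k" "[]"] k by (force simp: not_less)
  have "0 \<le> 1 - 1 / (real k + 2)" by (simp add: field_simps)
  with s have "cond_cap (C k) s \<noteq> 0" by linarith
  \<comment> \<open>Positive capacity at \<open>s\<close> means that a branch of the slice passes
    through \<open>s\<close>; the bound on \<open>A\<close> is known only along such
    branches.\<close>
  then obtain x where x: "x \<in> C k" "prefix_of x (length s) = s"
    using cond_cap_eq_0[of "C k" s] by blast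
  have "cond_cap A s \<le> 1 - 1 / (real k + 2)"
    using x unfolding C_def by (metis (mono_tags, lifting) mem_Collect_eq)
  also note s
  also have "cond_cap (C k) s \<le> cond_cap (A \<union> B) s"
    by (rule cond_cap_mono) (auto simp: C_def)
  finally have "cond_cap A (prefix_of x (length s)) < cond_cap (A \<union> B) (prefix_of x (length s))"
    using x by simp
  then show ?thesis
    by (rule cond_cap_strict_prefix[rotated 2]) (use x B in \<open>auto simp: C_def\<close>)
qed

end

section \<open>Step functions and the limit norm\<close>

text \<open>A basic open box restricts finitely many coordinates, all below some \<open>N\<close>.
  Conversely, the factors being discrete, fixing the first \<open>N\<close> coordinates is an open
  condition.\<close>

lemma openin_product_space:
  "openin (product_space X) S \<longleftrightarrow>
     S \<subseteq> Pi\<^sub>E UNIV X \<and> (\<forall>x\<in>S. \<exists>N. \<forall>y\<in>Pi\<^sub>E UNIV X. (\<forall>i<N. y i = x i) \<longrightarrow> y \<in> S)"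
proof (intro iffI conjI ballI)
  assume S: "openin (product_space X) S"
  then show sub: "S \<subseteq> Pi\<^sub>E UNIV X" using openin_subset by fastforce
  fix x assume "x \<in> S"
  then obtain U where U: "finite {i. U i \<noteq> X i}" "x \<in> Pi\<^sub>E UNIV U" "Pi\<^sub>E UNIV U \<subseteq> S"
    using S unfolding openin_product_topology_alt by auto
  obtain N where N: "\<And>i. U i \<noteq> X i \<Longrightarrow> i < N"
    using finite_nat_set_iff_bounded U(1) by auto
  have mem: "y \<in> S" if y: "y \<in> Pi\<^sub>E UNIV X" "\<forall>i<N. y i = x i" for y
  proof -
    have "y i \<in> U i" for i
      using y U(2) N[of i] by (cases "i < N") (force simp: PiE_iff)+
    then show ?thesis using U(3) by (auto simp: PiE_iff)
  qed
  show "\<exists>N. \<forall>y\<in>Pi\<^sub>E UNIV X. (\<forall>i<N. y i = x i) \<longrightarrow> y \<in> S"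
    by (intro exI[of _ N] ballI impI mem)
next
  assume S: "S \<subseteq> Pi\<^sub>E UNIV X \<and> (\<forall>x\<in>S. \<exists>N. \<forall>y\<in>Pi\<^sub>E UNIV X. (\<forall>i<N. y i = x i) \<longrightarrow> y \<in> S)"
  show "openin (product_space X) S"
    unfolding openin_product_topology_alt
  proof
    fix x assume x: "x \<in> S"
    obtain N where N: "\<forall>y\<in>Pi\<^sub>E UNIV X. (\<forall>i<N. y i = x i) \<longrightarrow> y \<in> S"
      using bspec[OF conjunct2[OF S] x] by (rule exE)
    have xX: "x i \<in> X i" for i using x S by (auto simp: PiE_iff)
    define U where "U i = (if i < N then {x i} else X i)" for i
    have "finite {i \<in> UNIV. U i \<noteq> topspace (discrete_topology (X i))}"
      by (rule finite_subset[of _ "{..<N}"]) (auto simp: U_def split: if_splits)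
    moreover have "\<forall>i\<in>UNIV. openin (discrete_topology (X i)) (U i)" using xX by (auto simp: U_def)
    moreover have "x \<in> Pi\<^sub>E UNIV U" using xX by (auto simp: U_def PiE_iff)
    moreover have "Pi\<^sub>E UNIV U \<subseteq> S"
    proof
      fix y assume y: "y \<in> Pi\<^sub>E UNIV U"
      have yU: "y i \<in> U i" for i using y by (auto simp: PiE_iff)
      show "y \<in> S"
      proof (rule N[rule_format])
        show "y \<in> Pi\<^sub>E UNIV X" 
        proof -
          have "y i \<in> X i" for i using yU[of i] xX[of i] by (auto simp: U_def split: if_splits)
          then show ?thesis by (simp add: PiE_iff)
        qed
        show "y i = x i" if "i < N" for i using yU[of i] that by (simp add: U_def)
      qed
    qed
    ultimately show "\<exists>U. finite {i \<in> UNIV. U i \<noteq> topspace (discrete_topology (X i))} \<and>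
        (\<forall>i\<in>UNIV. openin (discrete_topology (X i)) (U i)) \<and> x \<in> Pi\<^sub>E UNIV U \<and> Pi\<^sub>E UNIV U \<subseteq> S"
      by blast
  qed
qed

lemma openin_product_spaceD:
  "openin (product_space X) S \<Longrightarrow> x \<in> S \<Longrightarrow> \<exists>N. \<forall>y\<in>Pi\<^sub>E UNIV X. (\<forall>i<N. y i = x i) \<longrightarrow> y \<in> S"
  unfolding openin_product_space by (elim conjE) (erule (1) bspec)

text \<open>The value type is arbitrary so that predicates are covered too. \<open>N\<close> counts
  coordinates: a step witness with index \<open>j\<close> corresponds to
  \<open>N = Suc j\<close>.\<close>

definition depends_below :: "(nat \<Rightarrow> 'a set) \<Rightarrow> nat \<Rightarrow> ((nat \<Rightarrow> 'a) \<Rightarrow> 'b) \<Rightarrow> bool" where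
  "depends_below X N f \<longleftrightarrow>
     (\<forall>x\<in>Pi\<^sub>E UNIV X. \<forall>y\<in>Pi\<^sub>E UNIV X. (\<forall>i<N. x i = y i) \<longrightarrow> f x = f y)"

lemma depends_belowD:
  "depends_below X N f \<Longrightarrow> x \<in> Pi\<^sub>E UNIV X \<Longrightarrow> y \<in> Pi\<^sub>E UNIV X \<Longrightarrow> (\<And>i. i < N \<Longrightarrow> x i = y i) \<Longrightarrow> f x = f y"
  unfolding depends_below_def by (drule (1) bspec)+ (erule mp, simp)

lemma depends_below_mono: "depends_below X N f \<Longrightarrow> N \<le> M \<Longrightarrow> depends_below X M f"
  unfolding depends_below_def by (intro ballI impI, (drule (1) bspec)+) (erule mp, simp)

lemma depends_belowI:
  "(\<And>x y. x \<in> Pi\<^sub>E UNIV X \<Longrightarrow> y \<in> Pi\<^sub>E UNIV X \<Longrightarrow> (\<And>i. i < N \<Longrightarrow> x i = y i) \<Longrightarrow> f x = f y) \<Longrightarrow>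
    depends_below X N f"
  unfolding depends_below_def by (intro ballI impI) metis

lemma depends_below_compose2:
  assumes "depends_below X N f" "depends_below X N g"
  shows "depends_below X N (\<lambda>x. h (f x) (g x))"
proof (rule depends_belowI)
  fix x y assume xy: "x \<in> Pi\<^sub>E UNIV X" "y \<in> Pi\<^sub>E UNIV X" "\<And>i. i < N \<Longrightarrow> x i = y i"
  have "f x = f y" by (rule depends_belowD[OF assms(1) xy])
  moreover have "g x = g y" by (rule depends_belowD[OF assms(2) xy])
  ultimately show "h (f x) (g x) = h (f y) (g y)" by simp
qed

lemma step_witness_depends: "step_witness X f j f' \<Longrightarrow> depends_below X (Suc j) f"
  unfolding step_witness_def depends_below_def
proof (intro ballI impI)
  fix x y assume f: "\<forall>x\<in>Pi\<^sub>E UNIV X. f x = f' (restrict x {..j})" "\<forall>i<Suc j. x i = y i"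
    and "x \<in> Pi\<^sub>E UNIV X" "y \<in> Pi\<^sub>E UNIV X"
  moreover from f(2) have "restrict x {..j} = restrict y {..j}" by (auto simp: restrict_def)
  ultimately show "f x = f y" by metis
qed

lemma
  assumes f: "step_approximation X f h"
  shows step_approximation_step: "nonneg_step X (f i)"
    and step_approximation_mono: "x \<in> Pi\<^sub>E UNIV X \<Longrightarrow> i \<le> j \<Longrightarrow> f i x \<le> f j x"
    and step_approximation_SUP: "x \<in> Pi\<^sub>E UNIV X \<Longrightarrow> (SUP i. ennreal (f i x)) = ennreal (h x)"
proof -
  show "nonneg_step X (f i)"
    using f unfolding step_approximation_def by (elim conjE allE)
  show "(SUP i. ennreal (f i x)) = ennreal (h x)" if "x \<in> Pi\<^sub>E UNIV X"
    using f that unfolding step_approximation_def by (elim conjE) (drule (1) bspec)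
  assume x: "x \<in> Pi\<^sub>E UNIV X" and "i \<le> j"
  have "f k x \<le> f (Suc k) x" for k
    using f x unfolding step_approximation_def by (elim conjE) (drule (1) bspec, erule spec)
  then show "f i x \<le> f j x" using \<open>i \<le> j\<close> by (rule lift_Suc_mono_le)
qed

lemma nonneg_step_nonneg: "nonneg_step X f \<Longrightarrow> x \<in> Pi\<^sub>E UNIV X \<Longrightarrow> 0 \<le> f x"
  unfolding nonneg_step_def by (elim conjE) (erule (1) bspec)

lemma openin_depends_below:
  assumes "depends_below X N P"
  shows "openin (product_space X) {x \<in> Pi\<^sub>E UNIV X. P x}"
  unfolding openin_product_space
proof (intro conjI ballI)
  fix x assume x: "x \<in> {x \<in> Pi\<^sub>E UNIV X. P x}"
  have "y \<in> {x \<in> Pi\<^sub>E UNIV X. P x}" if "y \<in> Pi\<^sub>E UNIV X" "\<forall>i<N. y i = x i" for y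
    using depends_belowD[OF assms that(1), of x] that x by simp
  then show "\<exists>N. \<forall>y\<in>Pi\<^sub>E UNIV X. (\<forall>i<N. y i = x i) \<longrightarrow> y \<in> {x \<in> Pi\<^sub>E UNIV X. P x}"
    by (intro exI[of _ N] ballI impI)
qed simp

section \<open>Iterated norms evaluated on the tree of lists\<close>

context good_norm_sequence
begin

text \<open>Entries outside \<open>X i\<close> are replaced, so that \<open>ext u\<close> lies in the product for every list \<open>u\<close>.\<close>

definition ext :: "'a list \<Rightarrow> nat \<Rightarrow> 'a" where
  "ext u i = (if i < length u \<and> u ! i \<in> X i then u ! i else (SOME a. a \<in> X i))"

lemma some_in_X: "(SOME a. a \<in> X i) \<in> X i"
  using nonempty_X by (simp add: some_in_eq)

lemma ext_in: "ext u \<in> Pi\<^sub>E UNIV X"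
  by (auto simp: ext_def PiE_iff some_in_X)

lemma ext_prefix_of: "x \<in> Pi\<^sub>E UNIV X \<Longrightarrow> i < j \<Longrightarrow> ext (prefix_of x j) i = x i"
  by (auto simp: ext_def prefix_of_def PiE_iff)

lemma ext_append: "i < length u \<Longrightarrow> ext (u @ v) i = ext u i"
  by (auto simp: ext_def nth_append)

lemma depends_ext_append:
  assumes "depends_below X N f" "N \<le> length u"
  shows "f (ext (u @ v)) = f (ext u)"
  by (rule depends_belowD[OF assms(1) ext_in ext_in]) (use assms(2) in \<open>simp add: ext_append\<close>)

lemma depends_ext_prefix_of:
  assumes "depends_below X N f" "x \<in> Pi\<^sub>E UNIV X"
  shows "f (ext (prefix_of x N)) = f x"
  by (rule depends_belowD[OF assms(1) ext_in assms(2)]) (simp add: ext_prefix_of assms(2))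

text \<open>\<open>ev k F s\<close> is the norm \<open>n\<^bsub>|s|\<^esub> * \<dots> * n\<^bsub>|s|+k-1\<^esub>\<close> of \<open>F\<close> on the \<open>k\<close>-step extensions of \<open>s\<close>.\<close>

primrec ev :: "nat \<Rightarrow> ('a list \<Rightarrow> real) \<Rightarrow> 'a list \<Rightarrow> real" where
  "ev 0 F s = F s"
| "ev (Suc k) F s = n (length s) (\<lambda>a. ev k F (s @ [a]))"

lemma ev_nonneg: "(\<And>u. 0 \<le> F u) \<Longrightarrow> 0 \<le> ev k F s"
  by (cases k) (auto simp: good_norm_nonneg[OF good])

lemma ev_mono:
  assumes "\<And>u. 0 \<le> F u"
  shows "(\<And>u. length u = length s + k \<Longrightarrow> F u \<le> G u) \<Longrightarrow> ev k F s \<le> ev k G s"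
proof (induction k arbitrary: s)
  case (Suc k)
  show ?case unfolding ev.simps
    by (rule good_norm_mono[OF good]) (auto intro!: ev_nonneg assms Suc.IH Suc.prems)
qed simp

text \<open>The norms read only entries from the sets \<open>X i\<close>, so agreement on legal
  extensions suffices.\<close>

lemma ev_cong:
  "(\<And>t. length t = k \<Longrightarrow> (\<And>i. i < k \<Longrightarrow> t ! i \<in> X (length s + i)) \<Longrightarrow> F (s @ t) = G (s @ t)) \<Longrightarrow>
    ev k F s = ev k G s"
proof (induction k arbitrary: s)
  case 0
  from this[of "[]"] show ?case by simp
next
  case (Suc k)
  show ?case unfolding ev.simps
  proof (rule good_norm_cong[OF good], rule Suc.IH)
    fix a t assume a: "a \<in> X (length s)" and t: "length t = k"
      "\<And>i. i < k \<Longrightarrow> t ! i \<in> X (length (s @ [a]) + i)"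
    have "(a # t) ! i \<in> X (length s + i)" if "i < Suc k" for i
      using a t(2)[of "i - 1"] that by (cases i) auto
    from Suc.prems[OF _ this] t(1) show "F ((s @ [a]) @ t) = G ((s @ [a]) @ t)" by simp
  qed
qed

lemma ev_add: "ev (j + k) F s = ev j (ev k F) s"
  by (induction j arbitrary: s) simp_all

lemma ev_add_const:
  assumes "0 \<le> e" "\<And>u. 0 \<le> F u"
  shows "ev k (\<lambda>u. F u + e) s \<le> ev k F s + e"
proof (induction k arbitrary: s)
  case (Suc k)
  have "ev (Suc k) (\<lambda>u. F u + e) s \<le> n (length s) (\<lambda>a. ev k F (s @ [a]) + e)"
    unfolding ev.simps
    by (rule good_norm_mono[OF good _ Suc.IH]) (auto intro!: ev_nonneg add_nonneg_nonneg assms)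
  also have "\<dots> \<le> ev (Suc k) F s + e"
    using good_norm_add_const[OF good assms(1)] by simp
  finally show ?case .
qed simp

lemma ev_le_supermartingale: "supermartingale [] g \<Longrightarrow> ev k g s \<le> g s"
proof (induction k arbitrary: s)
  case (Suc k)
  have "ev (Suc k) g s \<le> n (length s) (\<lambda>a. g (s @ [a]))"
    unfolding ev.simps
    by (rule good_norm_mono[OF good]) (use Suc in \<open>auto intro: ev_nonneg supermartingale_nonneg\<close>)
  also have "\<dots> \<le> g s" using supermartingale_step[OF Suc.prems, of s] by simp
  finally show ?case .
qed simp

lemma ev_depends_below:
  assumes "depends_below X N f" "\<And>x. x \<in> Pi\<^sub>E UNIV X \<Longrightarrow> 0 \<le> f x"
  shows "N \<le> length u \<Longrightarrow> ev k (\<lambda>u. f (ext u)) u = f (ext u)"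
proof (induction k arbitrary: u)
  case (Suc k)
  have "ev k (\<lambda>u. f (ext u)) (u @ [a]) = f (ext u)" for a
    using Suc.prems by (subst Suc.IH) (simp_all add: depends_ext_append[OF assms(1)])
  then have "ev (Suc k) (\<lambda>u. f (ext u)) u = n (length u) (\<lambda>_. f (ext u))"
    by (simp only: ev.simps)
  then show ?case using assms(2)[OF ext_in] by (simp add: good_norm_const[OF good])
qed simp

text \<open>Since each norm sends the constant 1 to 1, coordinates beyond \<open>N\<close> do not
  affect the result. All representations of a step function thus have the same norm.\<close>

lemma ev_level:
  assumes "depends_below X N f" "\<And>x. x \<in> Pi\<^sub>E UNIV X \<Longrightarrow> 0 \<le> f x" "N \<le> M"
  shows "ev M (\<lambda>u. f (ext u)) [] = ev N (\<lambda>u. f (ext u)) []"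
proof -
  have "ev M (\<lambda>u. f (ext u)) [] = ev N (ev (M - N) (\<lambda>u. f (ext u))) []"
    using ev_add[of N "M - N"] assms(3) by simp
  also have "\<dots> = ev N (\<lambda>u. f (ext u)) []"
    by (rule ev_cong) (simp add: ev_depends_below[OF assms(1,2)])
  finally show ?thesis .
qed

text \<open>\<open>iterated_norm\<close> grows by an innermost norm reading the last coordinate,
  whereas \<open>ev\<close> unfolds from the first; \<open>ev_add\<close> reconciles the two. The
  filler \<open>undefined\<close> is the one that \<open>restrict\<close> produces.\<close>

lemma iterated_norm_eq_ev:
  "iterated_norm n j f = ev (Suc j) (\<lambda>u. f (\<lambda>i. if i < length u then u ! i else undefined)) []"
proof (induction j arbitrary: f)
  case 0
  have "(\<lambda>_. undefined)(0 := a) = (\<lambda>i. if i < length [a] then [a] ! i else undefined)" for a :: 'a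
    by auto
  then show ?case by simp
next
  case (Suc j)
  let ?fn = "\<lambda>u i. if i < length u then u ! i else (undefined :: 'a)"
  have fn: "(?fn u)(length u := a) = ?fn (u @ [a])" for u a
    by (auto simp: nth_append)
  have "iterated_norm n (Suc j) f = ev (Suc j) (\<lambda>u. n (Suc j) (\<lambda>a. f ((?fn u)(Suc j := a)))) []"
    by (simp add: norm_iteration_def Suc.IH del: ev.simps)
  also have "\<dots> = ev (Suc j) (ev 1 (\<lambda>u. f (?fn u))) []"
  proof (rule ev_cong)
    fix t :: "'a list" assume "length t = Suc j"
    then show "n (Suc j) (\<lambda>a. f ((?fn ([] @ t))(Suc j := a))) = ev 1 (\<lambda>u. f (?fn u)) ([] @ t)"
      unfolding append_Nil using fn[of t] by simp
  qed
  also have "\<dots> = ev (Suc (Suc j)) (\<lambda>u. f (?fn u)) []"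
    using ev_add[of "Suc j" 1 "\<lambda>u. f (?fn u)" "[]"] by simp
  finally show ?case .
qed

lemma iterated_norm_step_witness:
  assumes "step_witness X f j f'"
  shows "iterated_norm n j f' = ev (Suc j) (\<lambda>u. f (ext u)) []"
  unfolding iterated_norm_eq_ev
proof (rule ev_cong)
  fix t :: "'a list" assume t: "length t = Suc j" "\<And>i. i < Suc j \<Longrightarrow> t ! i \<in> X (length [] + i)"
  have "restrict (ext t) {..j} = (\<lambda>i. if i < length t then t ! i else undefined)"
    using t by (auto simp: ext_def restrict_def fun_eq_iff)
  then show "f' (\<lambda>i. if i < length ([] @ t) then ([] @ t) ! i else undefined) = (\<lambda>u. f (ext u)) ([] @ t)"
    unfolding append_Nil using assms ext_in[of t] by (simp add: step_witness_def)
qed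

lemma step_witness_exists:
  assumes "depends_below X (Suc N) f"
  shows "\<exists>f'. step_witness X f N f'"
proof
  \<comment> \<open>Later coordinates are filled with chosen elements of \<open>X i\<close>, so that
    \<open>f\<close> is evaluated inside the product.\<close>
  show "step_witness X f N (\<lambda>s. f (\<lambda>i. if i \<le> N then s i else (SOME a. a \<in> X i)))"
    unfolding step_witness_def
  proof
    fix x assume x: "x \<in> Pi\<^sub>E UNIV X"
    show "f x = f (\<lambda>i. if i \<le> N then restrict x {..N} i else (SOME a. a \<in> X i))"
      by (rule depends_belowD[OF assms x]) (use x in \<open>auto simp: PiE_iff some_in_X\<close>)
  qed
qed

lemma nonneg_step_iff:
  "nonneg_step X f \<longleftrightarrow> (\<forall>x\<in>Pi\<^sub>E UNIV X. 0 \<le> f x) \<and> (\<exists>N. depends_below X N f)"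
  unfolding nonneg_step_def
  using step_witness_exists step_witness_depends depends_below_mono by (metis lessI less_imp_le)

lemma limit_norm_step_eq:
  assumes dep: "depends_below X N f" and f0: "\<And>x. x \<in> Pi\<^sub>E UNIV X \<Longrightarrow> 0 \<le> f x"
  shows "limit_norm_step X (iterated_norm n) f = ev N (\<lambda>u. f (ext u)) []"
  unfolding limit_norm_step_def
proof (rule the_equality)
  \<comment> \<open>A witness with index \<open>N\<close> reads \<open>N + 1\<close> coordinates;
    raising the level by one also covers \<open>N = 0\<close>.\<close>
  have "depends_below X (Suc N) f" using depends_below_mono[OF dep] by simp
  then obtain f' where f': "step_witness X f N f'" using step_witness_exists by blast
  have "ev N (\<lambda>u. f (ext u)) [] = iterated_norm n N f'"
    using iterated_norm_step_witness[OF f'] ev_level[OF dep f0, of "Suc N"] by simp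
  with f' show "\<exists>j f'. step_witness X f j f' \<and> ev N (\<lambda>u. f (ext u)) [] = iterated_norm n j f'" by blast
next
  fix r assume "\<exists>j f'. step_witness X f j f' \<and> r = iterated_norm n j f'"
  then obtain j f' where f': "step_witness X f j f'" "r = iterated_norm n j f'" by blast
  then have r: "r = ev (Suc j) (\<lambda>u. f (ext u)) []" using iterated_norm_step_witness by simp
  have dep': "depends_below X (Suc j) f" using f'(1) by (rule step_witness_depends)
  show "r = ev N (\<lambda>u. f (ext u)) []"
  proof (cases "Suc j \<le> N")
    case True
    then show ?thesis unfolding r using ev_level[OF dep' f0, of N] by simp
  next
    case False
    then show ?thesis unfolding r using ev_level[OF dep f0, of "Suc j"] by simp
  qed
qed

lemma limit_norm_step_nonneg:
  assumes "nonneg_step X f"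
  shows "0 \<le> limit_norm_step X (iterated_norm n) f"
proof -
  have f0: "\<And>x. x \<in> Pi\<^sub>E UNIV X \<Longrightarrow> 0 \<le> f x" using assms by (rule nonneg_step_nonneg)
  obtain N where "depends_below X N f" using assms by (auto simp: nonneg_step_iff)
  then have "limit_norm_step X (iterated_norm n) f = ev N (\<lambda>u. f (ext u)) []"
    using f0 by (rule limit_norm_step_eq)
  also have "0 \<le> \<dots>" by (rule ev_nonneg) (rule f0[OF ext_in])
  finally show ?thesis .
qed

lemma limit_norm_step_le_add:
  assumes f: "nonneg_step X f" and g: "nonneg_step X g" and "0 \<le> e"
    and le: "\<And>x. x \<in> Pi\<^sub>E UNIV X \<Longrightarrow> f x \<le> g x + e"
  shows "limit_norm_step X (iterated_norm n) f \<le> limit_norm_step X (iterated_norm n) g + e"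
proof -
  have f0: "\<And>x. x \<in> Pi\<^sub>E UNIV X \<Longrightarrow> 0 \<le> f x" and g0: "\<And>x. x \<in> Pi\<^sub>E UNIV X \<Longrightarrow> 0 \<le> g x"
    using f g by (auto simp: nonneg_step_iff)
  obtain N M where "depends_below X N f" "depends_below X M g"
    using f g by (auto simp: nonneg_step_iff)
  then have dep: "depends_below X (max N M) f" "depends_below X (max N M) g"
    by (auto intro: depends_below_mono)
  have "ev (max N M) (\<lambda>u. f (ext u)) [] \<le> ev (max N M) (\<lambda>u. (\<lambda>u. g (ext u)) u + e) []"
    by (rule ev_mono) (use f0 le ext_in in auto)
  also have "\<dots> \<le> ev (max N M) (\<lambda>u. g (ext u)) [] + e"
    by (rule ev_add_const) (use g0 ext_in assms(3) in auto)
  finally show ?thesis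
    by (simp add: limit_norm_step_eq[OF dep(1) f0] limit_norm_step_eq[OF dep(2) g0])
qed

section \<open>The limit norm of lower semicontinuous functions\<close>

lemma compact_product_space: "compact_space (product_space X)"
  by (simp add: compact_space_product_topology compact_space_discrete_topology finite_X)

text \<open>A Dini argument: the open sets where \<open>f i < g k + e\<close> cover the compact
  product, and as \<open>g\<close> increases, a single \<open>g l\<close> works everywhere. By
  symmetry the supremum is independent of the approximation, so \<open>limit_norm_lsc\<close> is
  well defined.\<close>

lemma step_approximation_SUP_le:
  assumes f: "step_approximation X f h" and g: "step_approximation X g h"
  shows "(SUP i. ennreal (limit_norm_step X (iterated_norm n) (f i))) \<le>
         (SUP i. ennreal (limit_norm_step X (iterated_norm n) (g i)))"
proof (rule SUP_least)
  fix i
  let ?L = "limit_norm_step X (iterated_norm n)"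
  show "ennreal (?L (f i)) \<le> (SUP i. ennreal (?L (g i)))"
  proof (rule ennreal_le_epsilon)
    fix e :: real assume e: "0 < e"
    have sf: "nonneg_step X (f i)" and sg: "nonneg_step X (g k)" for k
      using f g by (simp_all add: step_approximation_step)
    define K where "K k = {x \<in> Pi\<^sub>E UNIV X. f i x < g k x + e}" for k
    have "openin (product_space X) (K k)" for k
    proof -
      obtain N M where "depends_below X N (f i)" "depends_below X M (g k)"
        using sf sg[of k] by (auto simp: nonneg_step_iff)
      then have "depends_below X (max N M) (f i)" "depends_below X (max N M) (g k)"
        by (auto intro: depends_below_mono)
      then have "depends_below X (max N M) (\<lambda>x. f i x < g k x + e)"
        by (rule depends_below_compose2)
      then show ?thesis unfolding K_def by (rule openin_depends_below)
    qed
    moreover have "topspace (product_space X) \<subseteq> \<Union> (range K)"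
    proof
      fix x assume "x \<in> topspace (product_space X)"
      then have x: "x \<in> Pi\<^sub>E UNIV X" by simp
      have g0: "0 \<le> g k x" for k using nonneg_step_nonneg[OF sg x] .
      show "x \<in> \<Union> (range K)"
      \<comment> \<open>Negative reals become 0 in \<open>ennreal\<close>, so
        \<open>f i x - e\<close> may be compared there only when it is nonnegative. In the other
        case \<open>g 0 x \<ge> 0\<close> suffices.\<close>
      proof (cases "f i x < e")
        case True
        then have "x \<in> K 0" using x g0[of 0] by (simp add: K_def)
        then show ?thesis by blast
      next
        case False
        have "ennreal (f i x - e) < ennreal (f i x)" using False e by (intro ennreal_lessI) auto
        also have "\<dots> \<le> (SUP i. ennreal (f i x))" by (rule SUP_upper) simp
        also have "\<dots> = (SUP i. ennreal (g i x))"
          using step_approximation_SUP[OF f x] step_approximation_SUP[OF g x] by simp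
        finally obtain k where "ennreal (f i x - e) < ennreal (g k x)"
          by (auto simp: less_SUP_iff)
        then have "f i x - e < g k x" using False by (simp add: ennreal_less_iff)
        then have "x \<in> K k" using x by (simp add: K_def)
        then show ?thesis by blast
      qed
    qed
    ultimately obtain \<F> where F: "finite \<F>" "\<F> \<subseteq> range K" "topspace (product_space X) \<subseteq> \<Union>\<F>"
      using compact_product_space unfolding compact_space_alt by (metis (no_types, lifting) imageE)
    then obtain T where T: "finite T" "\<F> = K ` T" using finite_subset_image by metis
    then obtain l where l: "\<And>k. k \<in> T \<Longrightarrow> k \<le> l" using finite_nat_set_iff_bounded_le by auto
    have "f i x \<le> g l x + e" if x: "x \<in> Pi\<^sub>E UNIV X" for x
    proof -
      obtain k where "k \<in> T" "x \<in> K k" using F(3) T(2) x by auto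
      then show ?thesis using step_approximation_mono[OF g x l[of k]] by (simp add: K_def)
    qed
    then have "?L (f i) \<le> ?L (g l) + e"
      using e by (intro limit_norm_step_le_add sf sg) auto
    then have "ennreal (?L (f i)) \<le> ennreal (?L (g l) + e)" by (rule ennreal_leI)
    also have "\<dots> = ennreal (?L (g l)) + ennreal e"
      using limit_norm_step_nonneg[OF sg] e by (intro ennreal_plus) auto
    also have "ennreal (?L (g l)) \<le> (SUP i. ennreal (?L (g i)))" by (rule SUP_upper) simp
    finally show "ennreal (?L (f i)) \<le> (SUP i. ennreal (?L (g i))) + ennreal e"
      by (simp add: add_right_mono)
  qed
qed

lemma limit_norm_lsc_eq:
  assumes "step_approximation X f h"
  shows "limit_norm_lsc X (iterated_norm n) h = (SUP i. ennreal (limit_norm_step X (iterated_norm n) (f i)))"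
  unfolding limit_norm_lsc_def
  by (rule the_equality) (use assms in \<open>blast intro: antisym step_approximation_SUP_le\<close>)+

text \<open>The infimum of \<open>h\<close> over the cylinder of the first \<open>i\<close>
  coordinates depends on these alone and grows with \<open>i\<close>. Lower semicontinuity makes it
  converge to \<open>h\<close>.\<close>

lemma step_approximation_exists:
  assumes lsc: "lower_semicontinuous (product_space X) h"
    and h0: "\<And>x. x \<in> Pi\<^sub>E UNIV X \<Longrightarrow> 0 \<le> h x"
  shows "\<exists>f. step_approximation X f h"
proof
  define C where "C i x = {y \<in> Pi\<^sub>E UNIV X. \<forall>l<i. y l = x l}" for i x
  define f where "f i x = Inf (h ` C i x)" for i x
  have bdd: "bdd_below (h ` C i x)" for i x
    by (rule bdd_belowI[of _ 0]) (auto simp: C_def h0)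
  have self: "x \<in> C i x" if "x \<in> Pi\<^sub>E UNIV X" for i x using that by (simp add: C_def)
  have f0: "0 \<le> f i x" if "x \<in> Pi\<^sub>E UNIV X" for i x
    unfolding f_def by (rule cINF_greatest) (use self[OF that] h0 in \<open>auto simp: C_def\<close>)
  have fh: "f i x \<le> h x" if "x \<in> Pi\<^sub>E UNIV X" for i x
    unfolding f_def by (rule cINF_lower[OF bdd self[OF that]])
  show "step_approximation X f h"
    unfolding step_approximation_def
  proof (intro conjI allI ballI)
    fix i
    have "depends_below X i (f i)"
    proof (rule depends_belowI)
      fix x y :: "nat \<Rightarrow> 'a" assume "\<And>l. l < i \<Longrightarrow> x l = y l"
      then have "C i x = C i y" by (auto simp: C_def)
      then show "f i x = f i y" by (simp add: f_def)
    qed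
    then show "nonneg_step X (f i)" using f0 by (auto simp: nonneg_step_iff)
  next
    fix x i assume x: "x \<in> Pi\<^sub>E UNIV X"
    show "f i x \<le> f (Suc i) x"
      unfolding f_def
      by (rule cINF_superset_mono[OF _ bdd]) (use self[OF x] in \<open>auto simp: C_def\<close>)
  next
    fix x assume x: "x \<in> Pi\<^sub>E UNIV X"
    show "(SUP i. ennreal (f i x)) = ennreal (h x)"
    proof (rule antisym)
      show "(SUP i. ennreal (f i x)) \<le> ennreal (h x)"
        by (rule SUP_least) (use fh[OF x] in \<open>auto intro: ennreal_leI\<close>)
      show "ennreal (h x) \<le> (SUP i. ennreal (f i x))"
      proof (rule ennreal_le_epsilon)
        fix e :: real assume e: "0 < e"
        have "openin (product_space X) {y \<in> Pi\<^sub>E UNIV X. h x - e < h y}"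
          using lsc by (simp add: lower_semicontinuous_def)
        moreover have "x \<in> {y \<in> Pi\<^sub>E UNIV X. h x - e < h y}" using x e by simp
        ultimately obtain N where
          N: "\<forall>y\<in>Pi\<^sub>E UNIV X. (\<forall>i<N. y i = x i) \<longrightarrow> y \<in> {y \<in> Pi\<^sub>E UNIV X. h x - e < h y}"
          using openin_product_spaceD by (elim exE[rotated])
        have "h x - e \<le> f N x"
          unfolding f_def
        proof (rule cINF_greatest)
          fix y assume "y \<in> C N x"
          then show "h x - e \<le> h y" using N[rule_format, of y] by (simp add: C_def)
        qed (use self[OF x] in blast)
        then have "ennreal (h x) \<le> ennreal (f N x + e)" by (intro ennreal_leI) simp
        also have "\<dots> = ennreal (f N x) + ennreal e" using f0[OF x] e by (intro ennreal_plus) auto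
        also have "ennreal (f N x) \<le> (SUP i. ennreal (f i x))" by (rule SUP_upper) simp
        finally show "ennreal (h x) \<le> (SUP i. ennreal (f i x)) + ennreal e"
          by (simp add: add_right_mono)
      qed
    qed
  qed
qed

section \<open>The derived submeasure as a capacity\<close>

abbreviation limit_cap :: "(nat \<Rightarrow> 'a) set \<Rightarrow> ennreal" where
  "limit_cap \<equiv> derived_submeasure (limit_norm X (iterated_norm n))"

text \<open>Bounding the hitting time by \<open>N\<close> makes the indicator a step function; the
  union over \<open>N\<close> is the open set covered by \<open>g\<close>.\<close>

definition hit_by :: "('a list \<Rightarrow> real) \<Rightarrow> nat \<Rightarrow> (nat \<Rightarrow> 'a) set" where
  "hit_by g N = {x \<in> Pi\<^sub>E UNIV X. \<exists>j\<le>N. 1 \<le> g (prefix_of x j)}"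

lemma depends_hit_by: "depends_below X N (\<lambda>x. x \<in> hit_by g N)"
proof (rule depends_belowI)
  fix x y assume xy: "x \<in> Pi\<^sub>E UNIV X" "y \<in> Pi\<^sub>E UNIV X" "\<And>i. i < N \<Longrightarrow> x i = y i"
  have "prefix_of x j = prefix_of y j" if "j \<le> N" for j
    using that xy(3) by (simp add: prefix_of_eq_iff)
  then have "(\<exists>j\<le>N. 1 \<le> g (prefix_of x j)) = (\<exists>j\<le>N. 1 \<le> g (prefix_of y j))" by auto
  then show "(x \<in> hit_by g N) = (y \<in> hit_by g N)"
    using xy(1,2) by (simp only: hit_by_def mem_Collect_eq)
qed

lemma depends_indicator_hit_by: "depends_below X N (indicator (hit_by g N) :: _ \<Rightarrow> real)"
proof (rule depends_belowI)
  fix x y assume xy: "x \<in> Pi\<^sub>E UNIV X" "y \<in> Pi\<^sub>E UNIV X" "\<And>i. i < N \<Longrightarrow> x i = y i"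
  have "(x \<in> hit_by g N) = (y \<in> hit_by g N)" by (rule depends_belowD[OF depends_hit_by xy])
  then show "(indicator (hit_by g N) x :: real) = indicator (hit_by g N) y"
    by (simp add: indicator_def)
qed

lemma openin_hit: "openin (product_space X) (\<Union>N. hit_by g N)"
proof (rule openin_Union, clarify)
  fix N
  have "hit_by g N = {x \<in> Pi\<^sub>E UNIV X. x \<in> hit_by g N}" by (auto simp: hit_by_def)
  then show "openin (product_space X) (hit_by g N)"
    using openin_depends_below[OF depends_hit_by, of g N] by simp
qed

lemma captures_subset_hit:
  assumes "A \<subseteq> Pi\<^sub>E UNIV X" "captures A [] g"
  shows "A \<subseteq> (\<Union>N. hit_by g N)"
proof
  fix x assume x: "x \<in> A"
  obtain j where "1 \<le> g (prefix_of x j)" using captures_reaches[OF assms(2) x] by auto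
  then have "x \<in> hit_by g j" using x assms(1) unfolding hit_by_def by blast
  then show "x \<in> (\<Union>N. hit_by g N)" by blast
qed

text \<open>Freezing \<open>g\<close> at 1 once it has reached 1 gives a supermartingale that still
  dominates the indicator at level \<open>N\<close>.\<close>

lemma ev_hit_by_le:
  assumes g: "supermartingale [] g"
  shows "ev N (\<lambda>u. indicator (hit_by g N) (ext u)) [] \<le> g []"
proof -
  define P where "P u \<longleftrightarrow> (\<exists>j\<le>length u. 1 \<le> g (take j u))" for u
  define g' where "g' u = (if P u then 1 else g u)" for u
  have g0: "0 \<le> g u" for u using g by (rule supermartingale_nonneg)
  have g': "supermartingale [] g'"
  proof (rule supermartingaleI)
    show "0 \<le> g' u" for u by (simp add: g'_def g0)
    fix u
    show "n (length ([] @ u)) (\<lambda>a. g' ([] @ u @ [a])) \<le> g' ([] @ u)"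
    proof (cases "P u")
      case True
      then obtain j where "j \<le> length u" "1 \<le> g (take j u)" by (auto simp: P_def)
      then have "P (u @ [a])" for a unfolding P_def by (intro exI[of _ j]) simp
      with True show ?thesis by (simp add: g'_def good_norm_const[OF good])
    next
      case False
      have "g' (u @ [a]) \<le> g (u @ [a])" for a
      proof (cases "P (u @ [a])")
        case True
        then obtain j where j: "j \<le> Suc (length u)" "1 \<le> g (take j (u @ [a]))"
          by (auto simp: P_def)
        with False have "j = Suc (length u)" by (cases "j \<le> length u") (auto simp: P_def)
        with j True show ?thesis by (simp add: g'_def)
      qed (simp add: g'_def)
      then have "n (length u) (\<lambda>a. g' (u @ [a])) \<le> n (length u) (\<lambda>a. g (u @ [a]))"
        by (intro good_norm_mono[OF good]) (auto simp: g'_def g0)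
      also have "\<dots> \<le> g u" using supermartingale_step[OF g, of u] by simp
      finally show ?thesis using False by (simp add: g'_def)
    qed
  qed
  have le: "indicator (hit_by g N) (ext t) \<le> g' t"
    if t: "length t = N" "\<And>i. i < N \<Longrightarrow> t ! i \<in> X i" for t
  proof (cases "ext t \<in> hit_by g N")
    case True
    then obtain j where j: "j \<le> N" "1 \<le> g (prefix_of (ext t) j)" by (auto simp: hit_by_def)
    have "prefix_of (ext t) j = take j t"
      using t j(1) by (intro nth_equalityI) (auto simp: prefix_of_def ext_def)
    with j t have "P t" by (auto simp: P_def)
    then show ?thesis by (simp add: g'_def)
  qed (simp add: g'_def g0)
  \<comment> \<open>The domination \<open>le\<close> holds only at legal lists, while
    \<open>ev_mono\<close> asks for it at all lists of the given length. Taking the minimum changes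
    nothing at legal lists and supplies the inequality elsewhere.\<close>
  have "ev N (\<lambda>u. indicator (hit_by g N) (ext u)) [] = ev N (\<lambda>u. min (indicator (hit_by g N) (ext u)) (g' u)) []"
    by (rule ev_cong) (use le in auto)
  also have "\<dots> \<le> ev N g' []"
    by (rule ev_mono) (auto simp: g'_def g0)
  also have "\<dots> \<le> g' []" by (rule ev_le_supermartingale[OF g'])
  also have "\<dots> \<le> g []" by (simp add: g'_def P_def)
  finally show ?thesis .
qed

lemma step_approximation_hit:
  "step_approximation X (\<lambda>N. indicator (hit_by g N)) (indicator (\<Union>N. hit_by g N))"
  unfolding step_approximation_def
proof (intro conjI allI ballI)
  fix N
  show "nonneg_step X (indicator (hit_by g N))"
    using depends_indicator_hit_by by (auto simp: nonneg_step_iff)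
next
  fix x N
  have "hit_by g N \<subseteq> hit_by g (Suc N)" by (auto simp: hit_by_def intro: le_SucI)
  then show "(indicator (hit_by g N) x :: real) \<le> indicator (hit_by g (Suc N)) x"
    by (auto simp: indicator_def)
next
  fix x
  show "(SUP N. ennreal (indicator (hit_by g N) x)) = ennreal (indicator (\<Union>N. hit_by g N) x)"
  proof (rule antisym)
    show "(SUP N. ennreal (indicator (hit_by g N) x)) \<le> ennreal (indicator (\<Union>N. hit_by g N) x)"
      by (rule SUP_least, rule ennreal_leI) (auto simp: indicator_def)
    show "ennreal (indicator (\<Union>N. hit_by g N) x) \<le> (SUP N. ennreal (indicator (hit_by g N) x))"
    proof (cases "x \<in> (\<Union>N. hit_by g N)")
      case True
      then obtain N where "x \<in> hit_by g N" by blast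
      then have "ennreal (indicator (\<Union>N. hit_by g N) x) = ennreal (indicator (hit_by g N) x)"
        using True by simp
      also have "\<dots> \<le> (SUP N. ennreal (indicator (hit_by g N) x))" by (rule SUP_upper) simp
      finally show ?thesis .
    qed simp
  qed
qed

lemma lower_semicontinuous_indicator:
  assumes "openin T U"
  shows "lower_semicontinuous T (indicator U)"
  unfolding lower_semicontinuous_def
proof
  fix r :: real
  have "{x \<in> topspace T. r < indicator U x} = (if r < 0 then topspace T else if r < 1 then U else {})"
    using openin_subset[OF assms] by (auto simp: indicator_def split: if_splits)
  then show "openin T {x \<in> topspace T. r < indicator U x}" using assms by simp
qed

text \<open>The indicator of the open set hit by \<open>g\<close> is an admissible majorant, and its
  natural step approximations all have norm at most \<open>g []\<close>.\<close>

lemma limit_cap_le_captures: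
  assumes A: "A \<subseteq> Pi\<^sub>E UNIV X" and g: "captures A [] g"
  shows "limit_cap A \<le> ennreal (g [])"
proof -
  let ?h = "indicator (\<Union>N. hit_by g N) :: _ \<Rightarrow> real"
  have "limit_cap A \<le> limit_norm_lsc X (iterated_norm n) ?h"
    unfolding derived_submeasure_def limit_norm_def
  proof (rule Inf_lower, rule CollectI, rule exI[of _ ?h], intro conjI refl ballI)
    show "lower_semicontinuous (product_space X) ?h"
      by (rule lower_semicontinuous_indicator[OF openin_hit])
    show "\<bar>indicator A x\<bar> \<le> ?h x" for x
      using captures_subset_hit[OF A g] by (auto simp: indicator_def)
  qed
  also have "\<dots> = (SUP N. ennreal (limit_norm_step X (iterated_norm n) (indicator (hit_by g N))))"
    by (rule limit_norm_lsc_eq[OF step_approximation_hit])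
  also have "\<dots> \<le> ennreal (g [])"
  proof (rule SUP_least, rule ennreal_leI)
    fix N
    have "limit_norm_step X (iterated_norm n) (indicator (hit_by g N)) =
        ev N (\<lambda>u. indicator (hit_by g N) (ext u)) []"
      by (rule limit_norm_step_eq[OF depends_indicator_hit_by]) simp
    also have "\<dots> \<le> g []" by (rule ev_hit_by_le[OF captures_supermartingale[OF g]])
    finally show "limit_norm_step X (iterated_norm n) (indicator (hit_by g N)) \<le> g []" .
  qed
  finally show ?thesis .
qed

text \<open>This process is the conditional norm of \<open>f\<close> given the first coordinates.
  Truncated subtraction makes it equal to \<open>f\<close> from level \<open>N\<close> on, where it
  stays constant.\<close>

lemma supermartingale_ev:
  assumes dep: "depends_below X N f" and f0: "\<And>x. x \<in> Pi\<^sub>E UNIV X \<Longrightarrow> 0 \<le> f x"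
  shows "supermartingale [] (\<lambda>u. ev (N - length u) (\<lambda>v. f (ext v)) u)"
proof (rule supermartingaleI)
  show "0 \<le> ev (N - length u) (\<lambda>v. f (ext v)) u" for u
    by (rule ev_nonneg) (rule f0[OF ext_in])
  fix u
  show "n (length ([] @ u)) (\<lambda>a. ev (N - length ([] @ u @ [a])) (\<lambda>v. f (ext v)) ([] @ u @ [a]))
      \<le> ev (N - length ([] @ u)) (\<lambda>v. f (ext v)) ([] @ u)"
  proof (cases "length u < N")
    case True
    then have "N - length u = Suc (N - Suc (length u))" by simp
    then show ?thesis by simp
  next
    case False
    then show ?thesis
      using f0[OF ext_in, of u] by (simp add: depends_ext_append[OF dep] good_norm_const[OF good])
  qed
qed

text \<open>If step functions increase to \<open>h\<close>, the sets of points of \<open>A\<close>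
  where they are at least \<theta> < 1 increase to \<open>A\<close>. The maximal inequality for the
  conditional norms bounds each set, and continuity from below passes to \<open>A\<close>.\<close>

lemma cond_cap_le_limit_norm_lsc:
  assumes A: "A \<subseteq> Pi\<^sub>E UNIV X"
    and lsc: "lower_semicontinuous (product_space X) h"
    and h: "\<And>x. x \<in> Pi\<^sub>E UNIV X \<Longrightarrow> \<bar>indicator A x\<bar> \<le> h x"
  shows "ennreal (cond_cap A []) \<le> limit_norm_lsc X (iterated_norm n) h"
proof -
  let ?L = "limit_norm_step X (iterated_norm n)"
  have "0 \<le> h x" if "x \<in> Pi\<^sub>E UNIV X" for x using h[OF that] by linarith
  then obtain f where f: "step_approximation X f h" using step_approximation_exists[OF lsc] by blast
  have lsc_eq: "limit_norm_lsc X (iterated_norm n) h = (SUP i. ennreal (?L (f i)))"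
    by (rule limit_norm_lsc_eq[OF f])
  show ?thesis
  proof (cases "limit_norm_lsc X (iterated_norm n) h")
    case (real r)
    have L: "?L (f i) \<le> r" for i
    proof -
      have "ennreal (?L (f i)) \<le> ennreal r"
        unfolding real(2)[symmetric] lsc_eq by (rule SUP_upper) simp
      then show ?thesis using real(1) by simp
    qed
    have "cond_cap A [] \<le> r"
    proof (rule le_of_mult_le[OF cond_cap_le_1])
      fix k
      define \<theta> where "\<theta> = 1 - 1 / (real k + 2)"
      have \<theta>: "0 < \<theta>" "\<theta> < 1" by (simp_all add: \<theta>_def field_simps)
      \<comment> \<open>The supremum, which is at least 1 on \<open>A\<close>, need not be attained;
        a threshold strictly below 1 is passed at a finite index.\<close>
      define B where "B i = {x \<in> A. \<theta> \<le> f i x}" for i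
      have BX: "B i \<subseteq> Pi\<^sub>E UNIV X" for i
        using A unfolding B_def by (rule order_trans[rotated]) simp
      have "incseq B"
      proof (rule incseq_SucI, rule subsetI)
        fix i x assume x: "x \<in> B i"
        have "f i x \<le> f (Suc i) x"
          by (rule step_approximation_mono[OF f subsetD[OF BX x]]) simp
        then show "x \<in> B (Suc i)" using x by (simp add: B_def)
      qed
      moreover have "cond_cap (B i) [] \<le> r / \<theta>" for i
      proof -
        have fi: "nonneg_step X (f i)" by (rule step_approximation_step[OF f])
        have f0: "\<And>x. x \<in> Pi\<^sub>E UNIV X \<Longrightarrow> 0 \<le> f i x" by (rule nonneg_step_nonneg[OF fi])
        obtain N where N: "depends_below X N (f i)" using fi by (auto simp: nonneg_step_iff)
        have "\<theta> * cond_cap (B i) [] \<le> ev (N - length ([] :: 'a list)) (\<lambda>v. f i (ext v)) []"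
        proof (rule maximal_inequality[OF supermartingale_ev[OF N f0] \<theta>(1)])
          fix x assume x: "x \<in> B i"
          have "f i (ext (prefix_of x N)) = f i x"
            by (rule depends_ext_prefix_of[OF N subsetD[OF BX x]])
          then have "\<theta> \<le> ev (N - length (prefix_of x N)) (\<lambda>v. f i (ext v)) (prefix_of x N)"
            using x by (simp add: B_def)
          then show "\<exists>j. \<theta> \<le> ev (N - length (prefix_of x j)) (\<lambda>v. f i (ext v)) (prefix_of x j)"
            by (rule exI)
        qed
        also have "\<dots> = ?L (f i)" using limit_norm_step_eq[OF N f0] by simp
        also have "\<dots> \<le> r" by (rule L)
        finally show ?thesis using \<theta> by (simp add: field_simps)
      qed
      ultimately have "cond_cap (\<Union>i. B i) [] \<le> r / \<theta>"
        using BX by (intro cond_cap_UN_le)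
      moreover have "A \<subseteq> (\<Union>i. B i)"
      proof
        fix x assume x: "x \<in> A"
        then have xX: "x \<in> Pi\<^sub>E UNIV X" using A by blast
        have "ennreal \<theta> < ennreal 1" using \<theta> by (intro ennreal_lessI) auto
        also have "ennreal 1 \<le> ennreal (h x)" using h[OF xX] x by (intro ennreal_leI) simp
        also have "\<dots> = (SUP i. ennreal (f i x))" using step_approximation_SUP[OF f xX] by simp
        finally obtain i where "ennreal \<theta> < ennreal (f i x)" by (auto simp: less_SUP_iff)
        then have "\<theta> < f i x" using \<theta> by (simp add: ennreal_less_iff)
        then have "x \<in> B i" using x by (simp add: B_def)
        then show "x \<in> (\<Union>i. B i)" by blast
      qed
      then have "cond_cap A [] \<le> cond_cap (\<Union>i. B i) []" by (rule cond_cap_mono)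
      ultimately have "cond_cap A [] \<le> r / \<theta>" by simp
      then show "(1 - 1 / (real k + 2)) * cond_cap A [] \<le> r"
        unfolding \<theta>_def[symmetric] using \<theta> by (simp add: field_simps)
    qed
    then show ?thesis unfolding real(2) by (rule ennreal_leI)
  qed simp
qed

text \<open>This identifies the analytic definition with the game-like one, so the remaining claims
  become statements about \<open>cond_cap\<close> at the root.\<close>

lemma limit_cap_eq:
  assumes A: "A \<subseteq> Pi\<^sub>E UNIV X"
  shows "limit_cap A = ennreal (cond_cap A [])"
proof (rule antisym)
  show "limit_cap A \<le> ennreal (cond_cap A [])"
  proof (rule ennreal_le_epsilon)
    fix e :: real assume e: "0 < e"
    obtain g where g: "captures A [] g" "g [] < cond_cap A [] + e"
      using cond_cap_approx[OF e] by blast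
    have "limit_cap A \<le> ennreal (g [])" by (rule limit_cap_le_captures[OF A g(1)])
    also have "\<dots> \<le> ennreal (cond_cap A [] + e)" using g(2) by (intro ennreal_leI) simp
    also have "\<dots> = ennreal (cond_cap A []) + ennreal e"
      using e by (intro ennreal_plus cond_cap_nonneg) simp
    finally show "limit_cap A \<le> ennreal (cond_cap A []) + ennreal e" .
  qed
  show "ennreal (cond_cap A []) \<le> limit_cap A"
    unfolding derived_submeasure_def limit_norm_def
  proof (rule Inf_greatest)
    fix z assume "z \<in> {limit_norm_lsc X (iterated_norm n) g |g.
      lower_semicontinuous (product_space X) g \<and> (\<forall>x\<in>Pi\<^sub>E UNIV X. \<bar>indicator A x\<bar> \<le> g x)}"
    then obtain g where g: "z = limit_norm_lsc X (iterated_norm n) g"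
      "lower_semicontinuous (product_space X) g" "\<forall>x\<in>Pi\<^sub>E UNIV X. \<bar>indicator A x\<bar> \<le> g x"
      by (elim CollectE exE conjE)
    show "ennreal (cond_cap A []) \<le> z"
      unfolding g(1) by (rule cond_cap_le_limit_norm_lsc[OF A g(2)]) (rule bspec[OF g(3)])
  qed
qed

section \<open>Polishness, capacity axioms, outer regularity and stability\<close>

lemma Polish_product_space: "Polish_space (product_space X)"
  unfolding Polish_space_def
proof
  show "completely_metrizable_space (product_space X)"
    by (simp add: completely_metrizable_space_product_topology completely_metrizable_space_discrete_topology)
  show "separable_space (product_space X)"
    unfolding separable_space_def
  proof (intro exI conjI)
    \<comment> \<open>Extensions of finite lists meet every cylinder, and there are countably many
      of them.\<close>
    let ?C = "ext ` lists (\<Union>i. X i)"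
    have "countable (\<Union>i. X i)" by (rule countable_UN) (auto intro: countable_finite finite_X)
    then show "countable ?C" by (rule countable_image[OF countable_lists])
    show sub: "?C \<subseteq> topspace (product_space X)" using ext_in by auto
    have "x \<in> product_space X closure_of ?C" if x: "x \<in> topspace (product_space X)" for x
      unfolding in_closure_of
    proof (intro conjI x allI impI)
      fix T assume "x \<in> T \<and> openin (product_space X) T"
      then have T: "openin (product_space X) T" "x \<in> T" by simp_all
      obtain N where N: "\<forall>y\<in>Pi\<^sub>E UNIV X. (\<forall>i<N. y i = x i) \<longrightarrow> y \<in> T"
        using openin_product_spaceD[OF T] by (rule exE)
      have xX: "x \<in> Pi\<^sub>E UNIV X" using x by simp
      have "ext (prefix_of x N) \<in> T"
        by (rule N[rule_format, OF ext_in]) (rule ext_prefix_of[OF xX])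
      moreover have "prefix_of x N \<in> lists (\<Union>i. X i)" 
        using xX by (auto simp: prefix_of_def PiE_iff) metis
      ultimately show "\<exists>y. y \<in> ?C \<and> y \<in> T" by blast
    qed
    then show "product_space X closure_of ?C = topspace (product_space X)"
      by (intro antisym closure_of_subset_topspace subsetI)
  qed
qed

lemma capacity_limit_cap: "capacity_on (product_space X) limit_cap"
  unfolding capacity_on_def
proof (intro conjI allI impI)
  have top: "topspace (product_space X) = Pi\<^sub>E UNIV X" by simp
  show "Polish_space (product_space X)" by (rule Polish_product_space)
  show "limit_cap {} = 0" using cond_cap_eq_0[of "{}" "[]"] by (simp add: limit_cap_eq)
  show "limit_cap A \<le> limit_cap B" if "A \<subseteq> B \<and> B \<subseteq> topspace (product_space X)" for A B
  proof -
    have "A \<subseteq> Pi\<^sub>E UNIV X" "B \<subseteq> Pi\<^sub>E UNIV X" using that unfolding top by (blast intro: order_trans)+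
    then show ?thesis using that by (simp add: limit_cap_eq ennreal_leI cond_cap_mono)
  qed
  show "limit_cap (A \<union> B) \<le> limit_cap A + limit_cap B"
    if "A \<subseteq> topspace (product_space X) \<and> B \<subseteq> topspace (product_space X)" for A B
  proof -
    have AB: "A \<subseteq> Pi\<^sub>E UNIV X" "B \<subseteq> Pi\<^sub>E UNIV X" using that unfolding top by simp_all
    then have "A \<union> B \<subseteq> Pi\<^sub>E UNIV X" by (rule Un_least)
    then show ?thesis
      using ennreal_leI[OF cond_cap_Un[of A B "[]"]] AB
      by (simp only: limit_cap_eq ennreal_plus cond_cap_nonneg)
  qed
  show "limit_cap (\<Union>i. A i) = (SUP i. limit_cap (A i))"
    if "(\<forall>i. A i \<subseteq> topspace (product_space X)) \<and> incseq A" for A :: "nat \<Rightarrow> (nat \<Rightarrow> 'a) set"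
  proof -
    have A: "A i \<subseteq> Pi\<^sub>E UNIV X" for i using that unfolding top by simp
    then have UA: "(\<Union>i. A i) \<subseteq> Pi\<^sub>E UNIV X" by (rule UN_least)
    have inc: "incseq A" using that by simp
    have "ennreal (cond_cap (\<Union>i. A i) []) = (SUP i. ennreal (cond_cap (A i) []))"
    proof (rule antisym)
      show "(SUP i. ennreal (cond_cap (A i) [])) \<le> ennreal (cond_cap (\<Union>i. A i) [])"
        by (intro SUP_least ennreal_leI cond_cap_mono) blast
      show "ennreal (cond_cap (\<Union>i. A i) []) \<le> (SUP i. ennreal (cond_cap (A i) []))"
      proof (cases "SUP i. ennreal (cond_cap (A i) [])")
        case (real r)
        have "cond_cap (A i) [] \<le> r" for i
        proof -
          have "ennreal (cond_cap (A i) []) \<le> ennreal r"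
            unfolding real(2)[symmetric] by (rule SUP_upper) simp
          then show ?thesis using real(1) by simp
        qed
        then have "cond_cap (\<Union>i. A i) [] \<le> r" by (rule cond_cap_UN_le[OF A inc])
        then show ?thesis unfolding real(2) by (rule ennreal_leI)
      next
        case top
        show ?thesis unfolding top by simp
      qed
    qed
    then show ?thesis by (simp only: limit_cap_eq[OF A] limit_cap_eq[OF UA])
  qed
  show "limit_cap K < \<infinity>" if "compactin (product_space X) K" for K
    using compactin_subset_topspace[OF that] unfolding top by (simp add: limit_cap_eq)
qed

text \<open>A nearly optimal competitor \<open>g\<close> for \<open>A\<close> also captures the
  whole open set on which it reaches 1, so that set costs at most \<open>g []\<close>.\<close>

lemma outer_regular_limit_cap: "outer_regular (product_space X) limit_cap"
  unfolding outer_regular_def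
proof (intro allI impI)
  fix A assume "A \<subseteq> topspace (product_space X)"
  then have A: "A \<subseteq> Pi\<^sub>E UNIV X" by simp
  show "limit_cap A = Inf {limit_cap U |U. openin (product_space X) U \<and> A \<subseteq> U}"
  proof (rule antisym)
    show "limit_cap A \<le> Inf {limit_cap U |U. openin (product_space X) U \<and> A \<subseteq> U}"
    proof (rule Inf_greatest)
      fix z assume "z \<in> {limit_cap U |U. openin (product_space X) U \<and> A \<subseteq> U}"
      then obtain U where U: "z = limit_cap U" "openin (product_space X) U" "A \<subseteq> U" by blast
      have "U \<subseteq> Pi\<^sub>E UNIV X" using openin_subset[OF U(2)] by simp
      then show "limit_cap A \<le> z"
        unfolding U(1) using A U(3) by (simp add: limit_cap_eq ennreal_leI cond_cap_mono)
    qed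
    show "Inf {limit_cap U |U. openin (product_space X) U \<and> A \<subseteq> U} \<le> limit_cap A"
      unfolding limit_cap_eq[OF A]
    proof (rule ennreal_le_epsilon)
      fix e :: real assume e: "0 < e"
      obtain g where g: "captures A [] g" "g [] < cond_cap A [] + e"
        using cond_cap_approx[OF e] by blast
      let ?U = "\<Union>N. hit_by g N"
      have UX: "?U \<subseteq> Pi\<^sub>E UNIV X" using openin_subset[OF openin_hit[of g]] by simp
      have "1 * cond_cap ?U [] \<le> g []"
        by (rule maximal_inequality[OF captures_supermartingale[OF g(1)]]) (auto simp: hit_by_def)
      then have "cond_cap ?U [] \<le> cond_cap A [] + e" using g(2) by simp
      then have "limit_cap ?U \<le> ennreal (cond_cap A [] + e)"
        unfolding limit_cap_eq[OF UX] by (rule ennreal_leI)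
      also have "\<dots> = ennreal (cond_cap A []) + ennreal e"
        using e by (intro ennreal_plus cond_cap_nonneg) simp
      finally show "Inf {limit_cap U |U. openin (product_space X) U \<and> A \<subseteq> U}
          \<le> ennreal (cond_cap A []) + ennreal e"
        using captures_subset_hit[OF A g(1)] openin_hit[of g]
        by (intro Inf_lower2[of "limit_cap ?U"] CollectI exI[of _ ?U] conjI refl)
    qed
  qed
qed

text \<open>For fixed \<open>k\<close> and \<open>j\<close> the condition reads only
  \<open>j\<close> coordinates and is open, so the density points form a countable intersection of
  open sets.\<close>

lemma Borel_density_points:
  "density_points A \<in> sigma_sets (topspace (product_space X)) {U. openin (product_space X) U}"
proof -
  let ?S = "sigma_sets (topspace (product_space X)) {U. openin (product_space X) U}"
  define O' where "O' k = (\<Union>j. {x \<in> Pi\<^sub>E UNIV X. 1 - 1 / (real k + 2) < cond_cap A (prefix_of x j)})" for k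
  have "openin (product_space X) (O' k)" for k
    unfolding O'_def
  proof (rule openin_Union, clarify)
    fix j
    show "openin (product_space X) {x \<in> Pi\<^sub>E UNIV X. 1 - 1 / (real k + 2) < cond_cap A (prefix_of x j)}"
    proof (rule openin_depends_below[of _ j], rule depends_belowI)
      fix x y :: "nat \<Rightarrow> 'a" assume "\<And>i. i < j \<Longrightarrow> x i = y i"
      then have "prefix_of x j = prefix_of y j" by (simp add: prefix_of_eq_iff)
      then show "(1 - 1 / (real k + 2) < cond_cap A (prefix_of x j)) =
          (1 - 1 / (real k + 2) < cond_cap A (prefix_of y j))" by simp
    qed
  qed
  then have "O' k \<in> ?S" for k by (intro sigma_sets.Basic CollectI)
  moreover have "{U. openin (product_space X) U} \<subseteq> Pow (topspace (product_space X))"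
    by (intro subsetI PowI openin_subset) (erule CollectD)
  ultimately have "(\<Inter>k. O' k) \<in> ?S"
    by (intro sigma_sets_INTER UNIV_not_empty)
  moreover have "density_points A = (\<Inter>k. O' k)"
  proof (rule set_eqI)
    fix x
    have "x \<in> (\<Inter>k. O' k) \<longleftrightarrow>
      (\<forall>k. x \<in> Pi\<^sub>E UNIV X \<and> (\<exists>j. 1 - 1 / (real k + 2) < cond_cap A (prefix_of x j)))"
      by (simp only: O'_def INT_iff UN_iff mem_Collect_eq ball_UNIV bex_UNIV ex_simps)
    then show "x \<in> density_points A \<longleftrightarrow> x \<in> (\<Inter>k. O' k)"
      by (simp only: density_points_def mem_Collect_eq all_simps)
  qed
  ultimately show ?thesis by simp
qed

text \<open>The set demanded by stability is the envelope, Borel as the union of the open set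
  \<open>A\<close> with its density points.\<close>

lemma stable_limit_cap: "stable_capacity (product_space X) limit_cap"
  unfolding stable_capacity_def
proof (intro allI impI)
  let ?S = "sigma_sets (topspace (product_space X)) {U. openin (product_space X) U}"
  fix A assume open_A: "openin (product_space X) A"
  have A: "A \<subseteq> Pi\<^sub>E UNIV X" using openin_subset[OF open_A] by simp
  have "density_points A \<subseteq> Pi\<^sub>E UNIV X" unfolding density_points_def by (rule Collect_restrict)
  then have E: "envelope A \<subseteq> Pi\<^sub>E UNIV X" unfolding envelope_def using A by (intro Un_least)
  show "\<exists>A'\<in>?S. A \<subseteq> A' \<and> limit_cap A' = limit_cap A \<and>
      (\<forall>B. B \<subseteq> topspace (product_space X) - A' \<and> 0 < limit_cap B \<longrightarrow> limit_cap A < limit_cap (A \<union> B))"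
  proof (intro bexI[of _ "envelope A"] conjI allI impI)
    show "envelope A \<in> ?S"
      unfolding envelope_def using open_A by (intro sigma_sets_Un sigma_sets.Basic CollectI Borel_density_points)
    show "A \<subseteq> envelope A" by (simp add: envelope_def)
    show "limit_cap (envelope A) = limit_cap A"
      by (simp only: limit_cap_eq[OF A] limit_cap_eq[OF E] cond_cap_envelope[OF A])
    fix B assume "B \<subseteq> topspace (product_space X) - envelope A \<and> 0 < limit_cap B"
    then have B: "B \<subseteq> Pi\<^sub>E UNIV X - envelope A" "0 < limit_cap B" by simp_all
    have BX: "B \<subseteq> Pi\<^sub>E UNIV X" using B(1) by blast
    have AB: "A \<union> B \<subseteq> Pi\<^sub>E UNIV X" using A BX by (rule Un_least)
    have "0 < cond_cap B []" using B(2) by (simp add: limit_cap_eq[OF BX])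
    then have "cond_cap A [] < cond_cap (A \<union> B) []" by (rule cond_cap_envelope_strict[OF B(1)])
    then show "limit_cap A < limit_cap (A \<union> B)"
      unfolding limit_cap_eq[OF A] limit_cap_eq[OF AB] by (intro ennreal_lessI) (auto intro: le_less_trans cond_cap_nonneg)
  qed
qed

end

theorem mainTheorem15:
  fixes X :: "nat \<Rightarrow> 'a set"
    and n :: "nat \<Rightarrow> ('a \<Rightarrow> real) \<Rightarrow> real"
    and c :: "(nat \<Rightarrow> 'a) set \<Rightarrow> ennreal"
  assumes "\<And>i. finite (X i)"
    and "\<And>i. X i \<noteq> {}"
    and "\<And>i. good_norm (X i) (n i)"
    and "c = derived_submeasure (limit_norm X (iterated_norm n))"
  shows "capacity_on (product_space X) c \<and>
         outer_regular (product_space X) c \<and>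
         stable_capacity (product_space X) c"
proof -
  interpret good_norm_sequence X n by unfold_locales (fact assms)+
  show ?thesis
    unfolding assms(4)
    by (intro conjI capacity_limit_cap outer_regular_limit_cap stable_limit_cap)
qed

end
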